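(* Let $p\in\mathbb R\langle x\rangle$ be a symmetric free polynomial. The following are equivalent. (i) There exist a linear polynomial $\ell\in\mathbb R\langle x\rangle$ and finitely many linear polynomials $s_j\in\mathbb R\langle x\rangle$ such that $p(x)-p(0)=\ell(x)+\sum_j s_j^*(x)s_j(x)$; (ii) $p$ is matrix convex; (iii) for every $n$ and every $A\in\mathbb S_n(\mathbb R)$, the set $\mathcal D(A)=\{X\in\mathbb S_n(\mathbb R^g): A-p(X)\succ0\}$ is convex; (iv) $p(x)-p(0)$ is quasi-convex and $p(0)-p(x)$ is not a nonzero sum of squares.
   Context: Let $g$ be a positive integer and let $\mathbb R\langle x\rangle$ be the ring of polynomials over $\mathbb R$ in freely non-commuting variables $x=(x_1,\dots,x_g)$; its elements (free polynomials) are finite sums $p=\sum_w p_w w$ over words $w$ in $x$ with $p_w\in\mathbb R$, the empty word $\emptyset$ being the multiplicative identity. For a word $w=x_{j_1}\cdots x_{j_k}$ put $w^*=x_{j_k}\cdots x_{j_1}$, and extend to an involution by $p^*=\sum p_w w^*$. A polynomial $p$ is symmetric if $p^*=p$. $\mathbb S_n(\mathbb R)$ is the set of real symmetric $n\times n$ matrices, and $\mathbb S_n(\mathbb R^g)$ is the set of $g$-tuples $X=(X_1,\dots,X_g)$ of real symmetric $n\times n$ matrices. The evaluation is $p(X)=\sum p_w w(X)$ with $w(X)=X_{j_1}\cdots X_{j_k}$ and $\emptyset(X)=I_n$; so $p(0)=p_\emptyset I_n$ for $0\in\mathbb S_n(\mathbb R^g)$, and as a constant polynomial $p(0)$ means $p_\emptyset$.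 If $p$ is symmetric then $p(X)$ is a symmetric matrix. For symmetric matrices, $S\succ0$ and $S\succeq0$ mean positive definite and positive semidefinite, and $S\preceq T$ means $T-S\succeq0$. A symmetric polynomial $p$ is matrix convex if for each $n$, each pair $X,Y\in\mathbb S_n(\mathbb R^g)$ and each $0\le t\le1$, $p(tX+(1-t)Y)\preceq tp(X)+(1-t)p(Y)$. A symmetric polynomial $f$ is quasi-convex if $f(0)=0$ and, for each $n$ and each positive definite $n\times n$ matrix $A$, the set $\{X\in\mathbb S_n(\mathbb R^g): A-f(X)\succ0\}$ is convex. A symmetric polynomial $f$ is a (hermitian) sum of squares if there exist $m$ and $h_1,\dots,h_m\in\mathbb R\langle x\rangle$ with $f=\sum_j h_j^*h_j$. A linear polynomial is a real linear combination of $x_1,\dots,x_g$. *)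

theory Defs
  imports "HOL-Library.Poly_Mapping" "Jordan_Normal_Form.Matrix"
begin

section \<open>Free polynomials\<close>

text \<open>
  Words are lists of letters, and lists form the free monoid under concatenation.
  With this (additively written) monoid structure, the convolution product that
  Poly_Mapping provides on finitely supported functions is the product of
  the free algebra. The letters are the elements of a finite type, which is automatically
  nonempty, so its cardinality is the number g of variables.
\<close>

instantiation list :: (type) monoid_add
begin

definition zero_list :: "'a list" where "zero_list = []"
definition plus_list :: "'a list \<Rightarrow> 'a list \<Rightarrow> 'a list" where "plus_list u v = u @ v"

instance by standard (simp_all add: zero_list_def plus_list_def)

end

type_synonym 'g free_poly = "'g list \<Rightarrow>\<^sub>0 real"

definition adjoint_poly :: "'g free_poly \<Rightarrow> 'g free_poly" where
  "adjoint_poly p =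
    (\<Sum>w\<in>Poly_Mapping.keys p. Poly_Mapping.single (rev w) (Poly_Mapping.lookup p w))"

definition symmetric_poly :: "'g free_poly \<Rightarrow> bool" where
  "symmetric_poly p \<longleftrightarrow> adjoint_poly p = p"

text \<open>The value \<open>p(0)\<close>, read as a constant polynomial.\<close>

definition value_at_zero :: "'g free_poly \<Rightarrow> 'g free_poly" where
  "value_at_zero p = Poly_Mapping.single [] (Poly_Mapping.lookup p [])"

definition linear_poly :: "('g::finite) free_poly \<Rightarrow> bool" where
  "linear_poly p \<longleftrightarrow> (\<exists>c :: 'g \<Rightarrow> real. p = (\<Sum>j\<in>UNIV. Poly_Mapping.single [j] (c j)))"

definition sum_of_squares :: "'g free_poly \<Rightarrow> bool" where
  "sum_of_squares f \<longleftrightarrow>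
    (\<exists>(m::nat) (h :: nat \<Rightarrow> 'g free_poly). f = (\<Sum>j<m. adjoint_poly (h j) * h j))"

section \<open>Symmetric matrices and evaluation\<close>

definition sym_mats :: "nat \<Rightarrow> real mat set" where
  "sym_mats n = {A \<in> carrier_mat n n. transpose_mat A = A}"

definition sym_tuples :: "nat \<Rightarrow> ('g \<Rightarrow> real mat) set" where
  "sym_tuples n = {X. \<forall>j. X j \<in> sym_mats n}"

text \<open>
  The order \<open>\<le>\<close> that the matrix library puts on matrices is entrywise, so definiteness and
  the Loewner order are introduced separately.
\<close>

definition pos_def :: "nat \<Rightarrow> real mat \<Rightarrow> bool" where
  "pos_def n S \<longleftrightarrow> S \<in> sym_mats n \<and>
    (\<forall>v\<in>carrier_vec n. v \<noteq> 0\<^sub>v n \<longrightarrow> 0 < v \<bullet> (S *\<^sub>v v))"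

definition pos_semidef :: "nat \<Rightarrow> real mat \<Rightarrow> bool" where
  "pos_semidef n S \<longleftrightarrow> S \<in> sym_mats n \<and> (\<forall>v\<in>carrier_vec n. 0 \<le> v \<bullet> (S *\<^sub>v v))"

definition loewner_le :: "nat \<Rightarrow> real mat \<Rightarrow> real mat \<Rightarrow> bool" where
  "loewner_le n S T \<longleftrightarrow> pos_semidef n (T - S)"

primrec eval_word :: "nat \<Rightarrow> ('g \<Rightarrow> real mat) \<Rightarrow> 'g list \<Rightarrow> real mat" where
  "eval_word n X [] = 1\<^sub>m n"
| "eval_word n X (j # w) = X j * eval_word n X w"

text \<open>
  Matrices of all sizes share one type, which therefore carries no additive monoid structure;
  the finite sum of matrices is formed entrywise.
\<close>

definition eval_poly :: "nat \<Rightarrow> 'g free_poly \<Rightarrow> ('g \<Rightarrow> real mat) \<Rightarrow> real mat" where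
  "eval_poly n p X = mat n n (\<lambda>(i, k).
    \<Sum>w\<in>Poly_Mapping.keys p. Poly_Mapping.lookup p w * eval_word n X w $$ (i, k))"

section \<open>Convexity notions\<close>

definition segment_point ::
  "real \<Rightarrow> ('g \<Rightarrow> real mat) \<Rightarrow> ('g \<Rightarrow> real mat) \<Rightarrow> 'g \<Rightarrow> real mat" where
  "segment_point t X Y = (\<lambda>j. t \<cdot>\<^sub>m X j + (1 - t) \<cdot>\<^sub>m Y j)"

definition convex_tuples :: "('g \<Rightarrow> real mat) set \<Rightarrow> bool" where
  "convex_tuples K \<longleftrightarrow>
    (\<forall>X\<in>K. \<forall>Y\<in>K. \<forall>t. 0 \<le> t \<and> t \<le> 1 \<longrightarrow> segment_point t X Y \<in> K)"

definition sublevel_set :: "nat \<Rightarrow> 'g free_poly \<Rightarrow> real mat \<Rightarrow> ('g \<Rightarrow> real mat) set" where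
  "sublevel_set n p A = {X \<in> sym_tuples n. pos_def n (A - eval_poly n p X)}"

definition matrix_convex :: "'g free_poly \<Rightarrow> bool" where
  "matrix_convex p \<longleftrightarrow> symmetric_poly p \<and>
    (\<forall>n>0. \<forall>X\<in>sym_tuples n. \<forall>Y\<in>sym_tuples n. \<forall>t. 0 \<le> t \<and> t \<le> 1 \<longrightarrow>
      loewner_le n (eval_poly n p (segment_point t X Y))
        (t \<cdot>\<^sub>m eval_poly n p X + (1 - t) \<cdot>\<^sub>m eval_poly n p Y))"

definition quasi_convex :: "'g free_poly \<Rightarrow> bool" where
  "quasi_convex f \<longleftrightarrow> symmetric_poly f \<and> value_at_zero f = 0 \<and>
    (\<forall>n>0. \<forall>A. pos_def n A \<longrightarrow> convex_tuples (sublevel_set n f A))"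

end

theory Submission
  imports Defs "HOL-Analysis.Function_Topology"
begin

text \<open>
  The four conditions are all shown to be equivalent to one condition on the coefficients of
  \<open>p\<close>: no word of length above two occurs, and the matrix \<open>(p\<^sub>a\<^sub>b)\<close> of the coefficients of the
  words of length two is positive semidefinite (\<open>convex_quadratic\<close>). A factorization of that
  matrix gives the linear polynomials \<open>s\<^sub>j\<close>, and matrix convexity of such a polynomial is a
  direct computation. The substance lies in the way back.

  The first idea removes the matrix levels. Given a vector \<open>v\<close> and finitely many
  symmetric matrices \<open>M\<close> with \<open>v \<bullet> M v < \<delta>\<close>, some symmetric \<open>A\<close> satisfies \<open>v \<bullet> A v = \<delta>\<close>
  and \<open>A - M \<succ> 0\<close> for all of them: let \<open>A\<close> be huge on the orthogonal complement of \<open>v\<close>. Hence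
  convexity of all the sets \<open>{X. A - p(X) \<succ> 0}\<close> makes the scalar functions \<open>X \<mapsto> v \<bullet> p(X) v\<close>
  quasi-convex, with positive levels \<open>\<delta>\<close> sufficing when only positive definite \<open>A\<close> are at hand
  (\<open>scalar_midpoint\<close>).

  Suppose now that \<open>f = p - p(0)\<close> is quasi-convex and that \<open>u \<bullet> f(Y) u > 0\<close> for some \<open>Y\<close> and \<open>u\<close>.
  Let \<open>X\<close> be the direct sum of \<open>Y\<close> and a truncated Fock representation, and \<open>v\<close> the sum of a
  large multiple of \<open>u\<close> and the vacuum, so that \<open>v \<bullet> f(X) v > 0\<close>. Border every \<open>X\<^sub>a\<close> by one row and
  column \<open>t k\<^sub>a\<close> with corner entry \<open>0\<close>. Changing the sign of \<open>t\<close> does not change the value at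
  \<open>v\<close>, so quasi-convexity at the midpoint \<open>t = 0\<close> forces this value to be minimal there, and its
  second-order coefficient is nonnegative. That coefficient is
  \<open>\<Sum> f\<^bsub>m\<^sup>* a b n\<^esub> \<langle>k\<^sub>a, m(X) v\<rangle> \<langle>k\<^sub>b, n(X) v\<rangle>\<close>, and since the vectors \<open>m(X) v\<close> are linearly
  independent the numbers \<open>\<langle>k\<^sub>a, m(X) v\<rangle>\<close> can be prescribed at will
  (\<open>middle_matrix_nonneg\<close>). A word \<open>a b n\<close> of maximal length above two would give this
  positive semidefinite matrix a nonzero entry in the row of a vanishing diagonal entry, because
  \<open>n\<^sup>* b b n\<close> is too long to occur. So the degree is at most two, and the words of length
  two give a positive semidefinite matrix (\<open>convex_quadratic_if_quasi_convex\<close>).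

  If on the other hand \<open>- f\<close> is positive semidefinite everywhere, it is a sum of squares
  (\<open>sum_of_squares_if_nonneg\<close>, a theorem of Helton): otherwise a functional separates \<open>- f\<close>
  from the cone of sums of squares, and the Gelfand-Naimark-Segal construction turns it into a
  point and a vector at which \<open>- f\<close> is negative. By the last clause of the fourth condition
  \<open>f\<close> is then zero. That this clause follows from the third condition is again scalar
  quasi-convexity: if \<open>f = - \<Sum> h\<^sub>j\<^sup>* h\<^sub>j\<close> is nonzero, its values at the two opposite Fock
  tuples are negative at the vacuum, while the value at their midpoint \<open>0\<close> is \<open>0\<close>.
\<close>

section \<open>Linear functionals on free polynomials\<close>

text \<open>
  A functional is given by its values on words. Evaluating a quadratic form \<open>v \<bullet> p(X) v\<close>, or a
  single matrix entry of \<open>p(X)\<close>, is of this kind.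
\<close>

definition functional :: "('g list \<Rightarrow> real) \<Rightarrow> 'g free_poly \<Rightarrow> real" where
  "functional L p = (\<Sum>w\<in>Poly_Mapping.keys p. Poly_Mapping.lookup p w * L w)"

lemma functional_superset:
  assumes "finite A" "Poly_Mapping.keys p \<subseteq> A"
  shows "functional L p = (\<Sum>w\<in>A. Poly_Mapping.lookup p w * L w)"
  unfolding functional_def
  by (rule sum.mono_neutral_left) (use assms in \<open>auto simp: in_keys_iff\<close>)

lemma functional_add: "functional L (p + q) = functional L p + functional L q"
proof -
  let ?A = "Poly_Mapping.keys p \<union> Poly_Mapping.keys q"
  have "Poly_Mapping.keys (p + q) \<subseteq> ?A" by (rule Poly_Mapping.keys_add)
  then show ?thesis
    by (simp add: functional_superset[of ?A] lookup_add distrib_right sum.distrib)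
qed

lemma functional_zero [simp]: "functional L 0 = 0"
  by (simp add: functional_def)

lemma functional_uminus: "functional L (- p) = - functional L p"
  by (simp add: functional_def sum_negf)

lemma functional_diff: "functional L (p - q) = functional L p - functional L q"
  using functional_add[of L p "- q"] by (simp add: functional_uminus)

lemma functional_sum: "functional L (\<Sum>a\<in>A. p a) = (\<Sum>a\<in>A. functional L (p a))"
  by (induction A rule: infinite_finite_induct) (simp_all add: functional_add)

lemma functional_single [simp]: "functional L (Poly_Mapping.single w c) = c * L w"
  by (simp add: functional_def)

lemma poly_as_sum_of_words:
  fixes p :: "'g free_poly"
  assumes "finite A" "Poly_Mapping.keys p \<subseteq> A"
  shows "p = (\<Sum>w\<in>A. Poly_Mapping.single w (Poly_Mapping.lookup p w))"
proof (rule poly_mapping_eqI)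
  fix u
  have "(\<Sum>w\<in>A. Poly_Mapping.lookup (Poly_Mapping.single w (Poly_Mapping.lookup p w)) u)
      = (\<Sum>w\<in>A. if w = u then Poly_Mapping.lookup p u else 0)"
    by (intro sum.cong) (auto simp: lookup_single when_def)
  also have "\<dots> = Poly_Mapping.lookup p u"
    using assms by (auto simp: in_keys_iff subset_iff)
  finally show "Poly_Mapping.lookup p u =
      Poly_Mapping.lookup (\<Sum>w\<in>A. Poly_Mapping.single w (Poly_Mapping.lookup p w)) u"
    by (simp add: lookup_sum)
qed

lemma lookup_adjoint_poly: "Poly_Mapping.lookup (adjoint_poly p) w = Poly_Mapping.lookup p (rev w)"
proof -
  have "Poly_Mapping.lookup (adjoint_poly p) w
      = (\<Sum>u\<in>Poly_Mapping.keys p. if u = rev w then Poly_Mapping.lookup p (rev w) else 0)"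
    unfolding adjoint_poly_def lookup_sum
    by (intro sum.cong) (auto simp: lookup_single when_def)
  then show ?thesis by (simp add: in_keys_iff)
qed

lemma symmetric_poly_iff:
  "symmetric_poly p \<longleftrightarrow> (\<forall>w. Poly_Mapping.lookup p (rev w) = Poly_Mapping.lookup p w)"
  unfolding symmetric_poly_def by (metis lookup_adjoint_poly poly_mapping_eqI)

lemma square_as_sum_of_words:
  fixes h :: "'g free_poly"
  assumes "finite A" "Poly_Mapping.keys h \<subseteq> A"
  shows "adjoint_poly h * h = (\<Sum>u\<in>A. \<Sum>w\<in>A.
    Poly_Mapping.single (rev u @ w) (Poly_Mapping.lookup h u * Poly_Mapping.lookup h w))"
proof -
  have fin: "finite (rev ` A)" using assms by simp
  have "Poly_Mapping.keys (adjoint_poly h) \<subseteq> rev ` A"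
  proof
    fix w assume "w \<in> Poly_Mapping.keys (adjoint_poly h)"
    then have "rev w \<in> A"
      using assms(2) by (auto simp: in_keys_iff lookup_adjoint_poly)
    then show "w \<in> rev ` A" by (metis image_eqI rev_rev_ident)
  qed
  from poly_as_sum_of_words[OF fin this]
  have "adjoint_poly h
      = (\<Sum>u\<in>A. Poly_Mapping.single (rev u) (Poly_Mapping.lookup h u))"
    by (simp add: sum.reindex lookup_adjoint_poly)
  then show ?thesis
    using poly_as_sum_of_words[OF assms]
    by (metis (no_types, lifting) mult_single plus_list_def sum.cong sum_product)
qed

lemma functional_square:
  assumes "finite A" "Poly_Mapping.keys h \<subseteq> A"
  shows "functional L (adjoint_poly h * h) = (\<Sum>u\<in>A. \<Sum>w\<in>A.
    Poly_Mapping.lookup h u * Poly_Mapping.lookup h w * L (rev u @ w))"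
  by (simp add: square_as_sum_of_words[OF assms] functional_sum)

section \<open>Tuples of symmetric kernels on a finite index set\<close>

text \<open>
  Matrices are handled as real functions on \<open>I \<times> I\<close> for a finite index set \<open>I\<close> of any type. This
  way words, disjoint sums and sets with one added point serve as index sets directly, and only
  the transfer to matrices has to choose an enumeration.
\<close>

definition ip :: "'i set \<Rightarrow> ('i \<Rightarrow> real) \<Rightarrow> ('i \<Rightarrow> real) \<Rightarrow> real" where
  "ip I u v = (\<Sum>i\<in>I. u i * v i)"

definition app :: "'i set \<Rightarrow> ('i \<Rightarrow> 'i \<Rightarrow> real) \<Rightarrow> ('i \<Rightarrow> real) \<Rightarrow> 'i \<Rightarrow> real" where
  "app I M v = (\<lambda>i. ip I (M i) v)"

primrec act :: "'i set \<Rightarrow> ('g \<Rightarrow> 'i \<Rightarrow> 'i \<Rightarrow> real) \<Rightarrow> 'g list \<Rightarrow> ('i \<Rightarrow> real) \<Rightarrow> 'i \<Rightarrow> real" where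
  "act I X [] v = v"
| "act I X (a # w) v = app I (X a) (act I X w v)"

definition symmetric_kernels :: "'i set \<Rightarrow> ('g \<Rightarrow> 'i \<Rightarrow> 'i \<Rightarrow> real) \<Rightarrow> bool" where
  "symmetric_kernels I X \<longleftrightarrow> (\<forall>a. \<forall>i\<in>I. \<forall>k\<in>I. X a i k = X a k i)"

definition qform ::
  "'i set \<Rightarrow> ('g \<Rightarrow> 'i \<Rightarrow> 'i \<Rightarrow> real) \<Rightarrow> 'g free_poly \<Rightarrow> ('i \<Rightarrow> real) \<Rightarrow> real" where
  "qform I X p v = functional (\<lambda>w. ip I v (act I X w v)) p"

lemma ip_commute: "ip I u v = ip I v u"
  by (simp add: ip_def mult.commute)

lemma ip_cong: "(\<And>i. i \<in> I \<Longrightarrow> u i = u' i) \<Longrightarrow> (\<And>i. i \<in> I \<Longrightarrow> v i = v' i) \<Longrightarrow> ip I u v = ip I u' v'"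
  unfolding ip_def by (rule sum.cong) auto

lemma ip_add_right: "ip I u (\<lambda>i. v i + w i) = ip I u v + ip I u w"
  by (simp add: ip_def distrib_left sum.distrib)

lemma ip_add_left: "ip I (\<lambda>i. v i + w i) u = ip I v u + ip I w u"
  by (simp add: ip_def distrib_right sum.distrib)

lemma ip_scale_right: "ip I u (\<lambda>i. c * v i) = c * ip I u v"
  by (simp add: ip_def sum_distrib_left algebra_simps)

lemma ip_scale_left: "ip I (\<lambda>i. c * v i) u = c * ip I v u"
  by (simp add: ip_def sum_distrib_left algebra_simps)

lemma ip_sum_right: "ip I u (\<lambda>i. \<Sum>b\<in>B. v b i) = (\<Sum>b\<in>B. ip I u (v b))"
  unfolding ip_def by (simp add: sum_distrib_left) (rule sum.swap)

lemma ip_sum_left: "ip I (\<lambda>i. \<Sum>b\<in>B. v b i) u = (\<Sum>b\<in>B. ip I (v b) u)"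
  unfolding ip_def by (simp add: sum_distrib_right) (rule sum.swap)

lemma ip_self_nonneg: "0 \<le> ip I u u"
  by (simp add: ip_def sum_nonneg)

lemma ip_self_eq_0: "finite I \<Longrightarrow> ip I u u = 0 \<longleftrightarrow> (\<forall>i\<in>I. u i = 0)"
  by (simp add: ip_def sum_nonneg_eq_0_iff)

lemma ip_cauchy_schwarz:
  assumes "finite I"
  shows "(ip I u v)\<^sup>2 \<le> ip I u u * ip I v v"
proof (cases "ip I v v = 0")
  case True
  then have "ip I u v = 0" using assms by (simp add: ip_self_eq_0) (simp add: ip_def)
  with True show ?thesis by simp
next
  case False
  then have pos: "0 < ip I v v" using ip_self_nonneg[of I v] by simp
  have "0 \<le> ip I (\<lambda>i. ip I v v * u i + (- ip I u v) * v i) (\<lambda>i. ip I v v * u i + (- ip I u v) * v i)"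
    by (rule ip_self_nonneg)
  also have "\<dots> = ip I v v * (ip I u u * ip I v v - (ip I u v)\<^sup>2)"
    unfolding ip_add_left ip_add_right ip_scale_left ip_scale_right
    by (simp add: ip_commute[of I v u] power2_eq_square algebra_simps)
  finally show ?thesis using pos by (simp add: zero_le_mult_iff)
qed

lemma app_scale: "app I M (\<lambda>i. c * v i) = (\<lambda>i. c * app I M v i)"
  by (simp add: app_def ip_scale_right)

lemma app_cong: "(\<And>i. i \<in> I \<Longrightarrow> v i = v' i) \<Longrightarrow> app I M v = app I M v'"
  by (auto simp: app_def intro: ip_cong)

lemma ip_app_symmetric:
  assumes "\<And>i k. i \<in> I \<Longrightarrow> k \<in> I \<Longrightarrow> M i k = M k i"
  shows "ip I u (app I M v) = ip I (app I M u) v"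
proof -
  have "ip I u (app I M v) = (\<Sum>i\<in>I. \<Sum>k\<in>I. u i * M i k * v k)"
    by (simp add: ip_def app_def sum_distrib_left mult.assoc)
  also have "\<dots> = (\<Sum>k\<in>I. \<Sum>i\<in>I. u i * M i k * v k)" by (rule sum.swap)
  also have "\<dots> = ip I (app I M u) v"
    unfolding ip_def app_def sum_distrib_right
    by (intro sum.cong refl) (simp add: assms)
  finally show ?thesis .
qed

lemma act_append: "act I X (u @ w) v = act I X u (act I X w v)"
  by (induction u) simp_all

lemma ip_act_rev:
  assumes "symmetric_kernels I X"
  shows "ip I u (act I X w v) = ip I (act I X (rev w) u) v"
proof (induction w arbitrary: u)
  case (Cons a w)
  have "ip I u (act I X (a # w) v) = ip I (app I (X a) u) (act I X w v)"
    using assms by (simp add: ip_app_symmetric symmetric_kernels_def)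
  with Cons show ?case by (simp add: act_append)
qed simp

lemma act_scale: "act I X w (\<lambda>i. c * v i) = (\<lambda>i. c * act I X w v i)"
  by (induction w) (simp_all add: app_scale)

lemma act_uminus: "act I (\<lambda>a i k. - X a i k) w v = (\<lambda>i. (- 1) ^ length w * act I X w v i)"
proof (induction w)
  case (Cons a w)
  then show ?case
    by (simp add: app_def ip_scale_right) (simp add: ip_def sum_negf)
qed simp

lemma qform_scale: "qform I X p (\<lambda>i. c * v i) = c\<^sup>2 * qform I X p v"
  by (simp add: qform_def functional_def act_scale ip_scale_left ip_scale_right
      sum_distrib_left power2_eq_square algebra_simps)

lemma qform_uminus: "qform I X (- p) v = - qform I X p v"
  by (simp add: qform_def functional_uminus)

lemma qform_diff: "qform I X (p - q) v = qform I X p v - qform I X q v"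
  by (simp add: qform_def functional_diff)

lemma qform_square:
  fixes v :: "'i \<Rightarrow> real"
  assumes "symmetric_kernels I X" "finite A" "Poly_Mapping.keys h \<subseteq> A"
  defines "y \<equiv> (\<lambda>i. \<Sum>w\<in>A. Poly_Mapping.lookup h w * act I X w v i)"
  shows "qform I X (adjoint_poly h * h) v = ip I y y"
proof -
  have "ip I v (act I X (rev u @ w) v) = ip I (act I X u v) (act I X w v)" for u w
    by (simp add: act_append ip_act_rev[OF assms(1)])
  then show ?thesis
    unfolding qform_def functional_square[OF assms(2,3)] y_def
    by (simp add: ip_sum_left ip_sum_right ip_scale_left ip_scale_right sum_distrib_left
        mult.assoc)
qed

section \<open>Kernels and matrices\<close>

definition matrices_of :: "(nat \<Rightarrow> 'i) \<Rightarrow> nat \<Rightarrow> ('g \<Rightarrow> 'i \<Rightarrow> 'i \<Rightarrow> real) \<Rightarrow> 'g \<Rightarrow> real mat" where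
  "matrices_of e n X = (\<lambda>a. mat n n (\<lambda>(i, k). X a (e i) (e k)))"

definition vector_of :: "(nat \<Rightarrow> 'i) \<Rightarrow> nat \<Rightarrow> ('i \<Rightarrow> real) \<Rightarrow> real vec" where
  "vector_of e n v = vec n (\<lambda>i. v (e i))"

lemma eval_word_carrier:
  assumes "X \<in> sym_tuples n"
  shows "eval_word n X w \<in> carrier_mat n n"
proof (induction w)
  case (Cons a w)
  then show ?case
    using assms by (auto simp: sym_tuples_def sym_mats_def intro!: mult_carrier_mat)
qed simp

lemma eval_word_append:
  assumes "X \<in> sym_tuples n"
  shows "eval_word n X (u @ w) = eval_word n X u * eval_word n X w"
proof (induction u)
  case Nil
  show ?case using eval_word_carrier[OF assms, of w] by simp
next
  case (Cons a u)
  have "X a \<in> carrier_mat n n" using assms by (auto simp: sym_tuples_def sym_mats_def)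
  with Cons show ?case
    using eval_word_carrier[OF assms, of u] eval_word_carrier[OF assms, of w] by simp
qed

lemma transpose_eval_word:
  assumes "X \<in> sym_tuples n"
  shows "transpose_mat (eval_word n X w) = eval_word n X (rev w)"
proof (induction w)
  case (Cons a w)
  have "X a \<in> carrier_mat n n" "transpose_mat (X a) = X a"
    using assms by (auto simp: sym_tuples_def sym_mats_def)
  with Cons show ?case
    using eval_word_carrier[OF assms, of w]
    by (simp add: eval_word_append[OF assms] transpose_mult[of "X a" n n _ n])
qed simp

lemma eval_poly_carrier [simp]: "eval_poly n p X \<in> carrier_mat n n"
  by (simp add: eval_poly_def)

lemma eval_poly_symmetric:
  assumes "symmetric_poly p" "X \<in> sym_tuples n"
  shows "eval_poly n p X \<in> sym_mats n"
proof -
  have entry: "eval_word n X w $$ (k, i) = eval_word n X (rev w) $$ (i, k)"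
    if "i < n" "k < n" for w i k
  proof -
    have "eval_word n X (rev w) $$ (i, k) = transpose_mat (eval_word n X w) $$ (i, k)"
      by (simp add: transpose_eval_word[OF assms(2)])
    also have "\<dots> = eval_word n X w $$ (k, i)"
      using that eval_word_carrier[OF assms(2), of w] by simp
    finally show ?thesis by simp
  qed
  have lookup_rev: "Poly_Mapping.lookup p (rev w) = Poly_Mapping.lookup p w" for w
    using assms(1) by (simp add: symmetric_poly_iff)
  have "(\<Sum>w\<in>Poly_Mapping.keys p. Poly_Mapping.lookup p w * eval_word n X (rev w) $$ (i, k))
      = (\<Sum>w\<in>Poly_Mapping.keys p. Poly_Mapping.lookup p w * eval_word n X w $$ (i, k))" for i k
    by (rule sum.reindex_bij_witness[of _ rev rev]) (auto simp: lookup_rev in_keys_iff)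
  then have sum_entry: "(\<Sum>w\<in>Poly_Mapping.keys p. Poly_Mapping.lookup p w * eval_word n X w $$ (k, i))
      = (\<Sum>w\<in>Poly_Mapping.keys p. Poly_Mapping.lookup p w * eval_word n X w $$ (i, k))"
    if "i < n" "k < n" for i k
    using that by (simp only: entry[of i k])
  have "transpose_mat (eval_poly n p X) = eval_poly n p X"
    by (intro eq_matI) (auto simp: eval_poly_def intro: sum_entry)
  then show ?thesis by (simp add: sym_mats_def)
qed

lemma eval_word_matrices_of:
  fixes I :: "'i set"
  assumes "bij_betw e {..<n} I"
  shows "eval_word n (matrices_of e n X) w *\<^sub>v vector_of e n v = vector_of e n (act I X w v)
    \<and> eval_word n (matrices_of e n X) w \<in> carrier_mat n n"
proof (induction w)
  case Nil
  show ?case by (simp add: vector_of_def)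
next
  case (Cons a w)
  let ?X = "matrices_of e n X"
  have Xa: "?X a \<in> carrier_mat n n" by (simp add: matrices_of_def)
  have "(\<Sum>k<n. f (e k)) = (\<Sum>i\<in>I. f i)" for f :: "'i \<Rightarrow> real"
    using sum.reindex_bij_betw[OF assms] .
  then have "?X a *\<^sub>v vector_of e n u = vector_of e n (app I (X a) u)" for u
    by (intro eq_vecI)
      (simp_all add: matrices_of_def vector_of_def scalar_prod_def app_def ip_def
        atLeast0LessThan)
  with Cons Xa show ?case
    by (simp add: assoc_mult_mat_vec[of _ n n _ n] vector_of_def)
qed

lemma quadratic_form_eval_poly:
  assumes "\<And>w. eval_word n X w \<in> carrier_mat n n" "v \<in> carrier_vec n"
  shows "v \<bullet> (eval_poly n p X *\<^sub>v v) = functional (\<lambda>w. v \<bullet> (eval_word n X w *\<^sub>v v)) p"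
proof -
  have word: "v \<bullet> (eval_word n X w *\<^sub>v v)
      = (\<Sum>i<n. \<Sum>k<n. v $ i * eval_word n X w $$ (i, k) * v $ k)" for w
    using assms(1)[of w] assms(2)
    by (simp add: scalar_prod_def sum_distrib_left atLeast0LessThan mult.assoc)
  have "v \<bullet> (eval_poly n p X *\<^sub>v v)
      = (\<Sum>i<n. v $ i * (\<Sum>k<n. (\<Sum>w\<in>Poly_Mapping.keys p.
          Poly_Mapping.lookup p w * eval_word n X w $$ (i, k)) * v $ k))"
    using assms(2) by (simp add: eval_poly_def scalar_prod_def atLeast0LessThan)
  also have "\<dots> = (\<Sum>i<n. \<Sum>k<n. \<Sum>w\<in>Poly_Mapping.keys p.
          Poly_Mapping.lookup p w * (v $ i * eval_word n X w $$ (i, k) * v $ k))"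
    by (simp add: sum_distrib_left sum_distrib_right mult_ac)
  also have "\<dots> = (\<Sum>i<n. \<Sum>w\<in>Poly_Mapping.keys p. \<Sum>k<n.
          Poly_Mapping.lookup p w * (v $ i * eval_word n X w $$ (i, k) * v $ k))"
    by (intro sum.cong refl sum.swap)
  also have "\<dots> = (\<Sum>w\<in>Poly_Mapping.keys p. \<Sum>i<n. \<Sum>k<n.
          Poly_Mapping.lookup p w * (v $ i * eval_word n X w $$ (i, k) * v $ k))"
    by (rule sum.swap)
  finally show ?thesis
    by (simp add: functional_def word sum_distrib_left)
qed

lemma quadratic_form_matrices_of:
  assumes "bij_betw e {..<n} I"
  shows "vector_of e n v \<bullet> (eval_poly n p (matrices_of e n X) *\<^sub>v vector_of e n v)
    = qform I X p v"
proof -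
  have "vector_of e n v \<bullet> vector_of e n u = ip I v u" for u
    using sum.reindex_bij_betw[OF assms, of "\<lambda>i. v i * u i"]
    by (simp add: vector_of_def scalar_prod_def ip_def atLeast0LessThan)
  then show ?thesis
    using eval_word_matrices_of[OF assms]
    by (subst quadratic_form_eval_poly) (auto simp: qform_def vector_of_def)
qed

lemma matrices_of_sym_tuples:
  assumes "bij_betw e {..<n} I" "symmetric_kernels I X"
  shows "matrices_of e n X \<in> sym_tuples n"
  unfolding sym_tuples_def sym_mats_def matrices_of_def
  using assms by (auto intro!: eq_matI simp: symmetric_kernels_def bij_betw_def)

text \<open>Conversely, every tuple of symmetric matrices is given by kernels on \<open>{..<n}\<close>.\<close>

lemma quadratic_form_as_qform:
  assumes "X \<in> sym_tuples n" "v \<in> carrier_vec n"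
  shows "v \<bullet> (eval_poly n p X *\<^sub>v v)
    = qform {..<n} (\<lambda>a i k. X a $$ (i, k)) p (\<lambda>i. v $ i)"
    "symmetric_kernels {..<n} (\<lambda>a i k. X a $$ (i, k))"
proof -
  have X: "X a \<in> carrier_mat n n" "transpose_mat (X a) = X a" for a
    using assms(1) by (auto simp: sym_tuples_def sym_mats_def)
  have eqX: "matrices_of (\<lambda>i. i) n (\<lambda>a i k. X a $$ (i, k)) = X"
  proof (intro ext eq_matI)
    fix a i k
    assume "i < dim_row (X a)" "k < dim_col (X a)"
    then show "matrices_of (\<lambda>i. i) n (\<lambda>a i k. X a $$ (i, k)) a $$ (i, k) = X a $$ (i, k)"
      using X(1)[of a] by (simp add: matrices_of_def)
  qed (use carrier_matD[OF X(1)] in \<open>simp_all add: matrices_of_def\<close>)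
  have eqv: "vector_of (\<lambda>i. i) n (\<lambda>i. v $ i) = v"
    using assms(2) by (auto simp: vector_of_def)
  have "bij_betw (\<lambda>i. i) {..<n} {..<n}" by (simp add: bij_betw_def)
  from quadratic_form_matrices_of[OF this, of "\<lambda>i. v $ i" p "\<lambda>a i k. X a $$ (i, k)"]
  show "v \<bullet> (eval_poly n p X *\<^sub>v v)
    = qform {..<n} (\<lambda>a i k. X a $$ (i, k)) p (\<lambda>i. v $ i)"
    unfolding eqX eqv .
  have "X a $$ (i, k) = X a $$ (k, i)" if "i < n" "k < n" for a i k
  proof -
    have "X a $$ (i, k) = transpose_mat (X a) $$ (i, k)" by (simp only: X(2))
    also have "\<dots> = X a $$ (k, i)" using that carrier_matD[OF X(1)[of a]] by simp
    finally show ?thesis .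
  qed
  then show "symmetric_kernels {..<n} (\<lambda>a i k. X a $$ (i, k))"
    by (simp add: symmetric_kernels_def)
qed

section \<open>From matrix sublevel sets to scalar sublevel sets\<close>

text \<open>
  The right-hand side is the form of \<open>K (|v|\<^sup>2 1 - v v\<^sup>T) + (\<delta> / |v|\<^sup>4) v v\<^sup>T\<close>. Split
  \<open>u = \<alpha> v + z\<close> with \<open>z\<close> orthogonal to \<open>v\<close>. In the direction of \<open>v\<close> there is the gap
  \<open>\<epsilon> = \<delta> - v \<bullet> M v\<close>; half of it, together with a large multiple of \<open>|z|\<^sup>2\<close>, absorbs the mixed
  term by the inequality between arithmetic and geometric mean.
\<close>

lemma rank_one_level_dominates:
  assumes "finite I" "symmetric_kernels I (\<lambda>_::unit. M)"
    and q: "0 < ip I v v" and level: "ip I v (app I M v) < \<delta>"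
  shows "\<exists>K0. \<forall>K\<ge>K0. \<forall>u. (\<exists>i\<in>I. u i \<noteq> 0) \<longrightarrow>
    ip I u (app I M u) < K * (ip I v v * ip I u u - (ip I v u)\<^sup>2) + \<delta> / (ip I v v)\<^sup>2 * (ip I v u)\<^sup>2"
proof -
  define q m \<epsilon> a c where "q = ip I v v" and "m = ip I v (app I M v)" and "\<epsilon> = \<delta> - m"
    and "a = ip I (app I M v) (app I M v)" and "c = (\<Sum>i\<in>I. ip I (M i) (M i))"
  \<comment> \<open>One of the two units of slack pays for \<open>z \<bullet> M z \<le> (c + 1) |z|\<^sup>2\<close>, the other for strictness.\<close>
  define K0 where "K0 = (c + 2 * a / \<epsilon> + 2) / q"
  have pos: "0 < q" "0 < \<epsilon>" "0 \<le> a" "0 \<le> c"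
    using q level by (auto simp: q_def m_def \<epsilon>_def a_def c_def ip_self_nonneg intro: sum_nonneg)
  have "ip I u (app I M u) < K * (q * ip I u u - (ip I v u)\<^sup>2) + \<delta> / q\<^sup>2 * (ip I v u)\<^sup>2"
    if K: "K \<ge> K0" and u: "\<exists>i\<in>I. u i \<noteq> 0" for K u
  proof -
    define \<alpha> where "\<alpha> = ip I v u / q"
    define z where "z = (\<lambda>i. u i + (- \<alpha>) * v i)"
    have u_eq: "u = (\<lambda>i. \<alpha> * v i + z i)" by (auto simp: z_def)
    have vu: "ip I v u = \<alpha> * q" using pos by (simp add: \<alpha>_def)
    have vz: "ip I v z = 0"
      unfolding z_def ip_add_right ip_scale_right vu q_def by simp
    have zv: "ip I z v = 0" using vz by (simp add: ip_commute)
    have uu: "ip I u u = \<alpha>\<^sup>2 * q + ip I z z"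
      by (simp add: u_eq ip_add_left ip_add_right ip_scale_left ip_scale_right vz zv
          q_def[symmetric] power2_eq_square)
    have Mu: "app I M u = (\<lambda>i. \<alpha> * app I M v i + app I M z i)"
      by (simp add: u_eq app_def ip_add_right ip_scale_right)
    have Mzv: "ip I v (app I M z) = ip I z (app I M v)"
      using assms(2) by (subst ip_app_symmetric) (auto simp: symmetric_kernels_def ip_commute)
    define b where "b = ip I z (app I M v)"
    have form: "ip I u (app I M u) = \<alpha>\<^sup>2 * m + 2 * \<alpha> * b + ip I z (app I M z)"
      unfolding Mu unfolding u_eq
      by (simp add: ip_add_left ip_add_right ip_scale_left ip_scale_right Mzv
          m_def b_def power2_eq_square algebra_simps)
    have zz: "0 \<le> ip I z z" by (rule ip_self_nonneg)
    have "ip I (app I M z) (app I M z) = (\<Sum>i\<in>I. (ip I (M i) z)\<^sup>2)"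
      unfolding ip_def[of I "app I M z"] by (simp add: app_def power2_eq_square)
    also have "\<dots> \<le> (\<Sum>i\<in>I. ip I (M i) (M i) * ip I z z)"
      by (intro sum_mono ip_cauchy_schwarz assms(1))
    finally have Mz: "ip I (app I M z) (app I M z) \<le> c * ip I z z"
      by (simp add: c_def sum_distrib_right)
    have "(ip I z (app I M z))\<^sup>2 \<le> ip I z z * (c * ip I z z)"
      using ip_cauchy_schwarz[OF assms(1), of z "app I M z"] mult_left_mono[OF Mz zz] by linarith
    also have "\<dots> \<le> ((c + 1) * ip I z z)\<^sup>2"
    proof -
      have "c \<le> (c + 1)\<^sup>2" using pos by (simp add: power2_eq_square algebra_simps)
      then have "c * (ip I z z)\<^sup>2 \<le> (c + 1)\<^sup>2 * (ip I z z)\<^sup>2" by (intro mult_right_mono) auto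
      then show ?thesis by (simp add: power2_eq_square algebra_simps)
    qed
    finally have zMz: "ip I z (app I M z) \<le> (c + 1) * ip I z z"
      using pos zz by (auto dest: power2_le_imp_le)
    have "b\<^sup>2 \<le> a * ip I z z"
      using ip_cauchy_schwarz[OF assms(1), of z "app I M v"] by (simp add: b_def a_def mult.commute)
    then have "2 / \<epsilon> * b\<^sup>2 \<le> 2 / \<epsilon> * (a * ip I z z)"
      using pos by (intro mult_left_mono) auto
    moreover have "2 * \<alpha> * b \<le> \<epsilon> / 2 * \<alpha>\<^sup>2 + 2 / \<epsilon> * b\<^sup>2"
    proof -
      have "0 \<le> (\<epsilon> * \<alpha> - 2 * b)\<^sup>2 / (2 * \<epsilon>)" using pos by simp
      also have "\<dots> = \<epsilon> / 2 * \<alpha>\<^sup>2 + 2 / \<epsilon> * b\<^sup>2 - 2 * \<alpha> * b"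
        using pos by (simp add: field_simps power2_eq_square)
      finally show ?thesis by simp
    qed
    ultimately have upper: "ip I u (app I M u)
        \<le> \<alpha>\<^sup>2 * m + \<epsilon> / 2 * \<alpha>\<^sup>2 + 2 / \<epsilon> * (a * ip I z z) + (c + 1) * ip I z z"
      unfolding form using zMz by linarith
    also have "\<dots> = \<alpha>\<^sup>2 * \<delta> - \<epsilon> / 2 * \<alpha>\<^sup>2 - ip I z z + K0 * q * ip I z z"
      using pos by (simp add: K0_def \<epsilon>_def field_simps)
    finally have 1: "ip I u (app I M u) \<le> \<alpha>\<^sup>2 * \<delta> - \<epsilon> / 2 * \<alpha>\<^sup>2 - ip I z z + K0 * q * ip I z z" .
    have rhs: "K * (q * ip I u u - (ip I v u)\<^sup>2) + \<delta> / q\<^sup>2 * (ip I v u)\<^sup>2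
        = K * q * ip I z z + \<alpha>\<^sup>2 * \<delta>"
      unfolding uu vu using pos by (simp add: power2_eq_square algebra_simps)
    have Kq: "K0 * q * ip I z z \<le> K * q * ip I z z"
      using K pos zz by (intro mult_right_mono) auto
    have "0 < \<epsilon> / 2 * \<alpha>\<^sup>2 + ip I z z"
    proof (cases "\<alpha> = 0")
      case True
      then have "u = z" by (simp add: u_eq)
      then have "ip I z z \<noteq> 0" using u ip_self_eq_0[OF assms(1), of z] by auto
      with True zz show ?thesis by simp
    qed (use pos zz in \<open>simp add: add_pos_nonneg\<close>)
    with 1 Kq rhs show ?thesis by linarith
  qed
  then show ?thesis unfolding q_def by blast
qed

lemma quadratic_form_ip:
  assumes "M \<in> carrier_mat n n" "v \<in> carrier_vec n"
  shows "v \<bullet> (M *\<^sub>v v) = ip {..<n} (($) v) (app {..<n} (\<lambda>i k. M $$ (i, k)) (($) v))"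
  using assms by (simp add: ip_def app_def scalar_prod_def atLeast0LessThan)

lemma quadratic_form_minus:
  fixes u :: "real vec"
  assumes "A \<in> carrier_mat n n" "M \<in> carrier_mat n n" "u \<in> carrier_vec n"
  shows "u \<bullet> ((A - M) *\<^sub>v u) = u \<bullet> (A *\<^sub>v u) - u \<bullet> (M *\<^sub>v u)"
  unfolding minus_mult_distrib_mat_vec[OF assms]
  by (rule scalar_prod_minus_distrib) (use assms in auto)

lemma nonzero_vec_entry:
  assumes "v \<in> carrier_vec n" "v \<noteq> 0\<^sub>v n"
  shows "\<exists>i\<in>{..<n}. v $ i \<noteq> 0"
proof (rule ccontr)
  assume "\<not> (\<exists>i\<in>{..<n}. v $ i \<noteq> 0)"
  then have "v = 0\<^sub>v n" using assms(1) by (intro eq_vecI) auto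
  with assms(2) show False by simp
qed

text \<open>
  A matrix level that is invisible except in the direction of \<open>v\<close>. Including the zero matrix in
  \<open>\<M>\<close>, which is possible when \<open>\<delta>\<close> is positive, makes \<open>A\<close> itself positive definite.
\<close>

lemma rank_one_level:
  assumes sym: "\<And>M. M \<in> \<M> \<Longrightarrow> M \<in> sym_mats n" and fin: "finite \<M>"
    and v: "v \<in> carrier_vec n" "v \<noteq> 0\<^sub>v n"
    and level: "\<And>M. M \<in> \<M> \<Longrightarrow> v \<bullet> (M *\<^sub>v v) < \<delta>"
  obtains A where "A \<in> sym_mats n" "v \<bullet> (A *\<^sub>v v) = \<delta>" "\<And>M. M \<in> \<M> \<Longrightarrow> pos_def n (A - M)"
proof -
  define q where "q = ip {..<n} (($) v) (($) v)"
  have "q \<noteq> 0"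
    unfolding q_def using ip_self_eq_0[of "{..<n}" "($) v"] nonzero_vec_entry[OF v] by auto
  then have q: "0 < q"
    using ip_self_nonneg[of "{..<n}" "($) v"] by (simp add: q_def)
  have "\<forall>M\<in>\<M>. \<exists>K0. \<forall>K\<ge>K0. \<forall>u. (\<exists>i\<in>{..<n}. u i \<noteq> 0) \<longrightarrow>
      ip {..<n} u (app {..<n} (\<lambda>i k. M $$ (i, k)) u)
      < K * (q * ip {..<n} u u - (ip {..<n} (($) v) u)\<^sup>2) + \<delta> / q\<^sup>2 * (ip {..<n} (($) v) u)\<^sup>2"
    unfolding q_def
  proof (intro ballI rank_one_level_dominates)
    fix M assume M: "M \<in> \<M>"
    then have carr: "M \<in> carrier_mat n n" and trans: "transpose_mat M = M"
      using sym by (auto simp: sym_mats_def)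
    have "M $$ (i, k) = M $$ (k, i)" if "i < n" "k < n" for i k
    proof -
      have "M $$ (i, k) = transpose_mat M $$ (i, k)" by (simp only: trans)
      also have "\<dots> = M $$ (k, i)" using that carrier_matD[OF carr] by simp
      finally show ?thesis .
    qed
    then show "symmetric_kernels {..<n} (\<lambda>_::unit. \<lambda>i k. M $$ (i, k))"
      by (simp add: symmetric_kernels_def)
    show "ip {..<n} (($) v) (app {..<n} (\<lambda>i k. M $$ (i, k)) (($) v)) < \<delta>"
      using level[OF M] quadratic_form_ip[of M n v] sym[OF M] v by (simp add: sym_mats_def)
  qed (use q in \<open>simp_all add: q_def\<close>)
  from bchoice[OF this] obtain K0 where K0: "\<And>M K u. M \<in> \<M> \<Longrightarrow> K \<ge> K0 M \<Longrightarrow> \<exists>i\<in>{..<n}. u i \<noteq> 0 \<Longrightarrow>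
      ip {..<n} u (app {..<n} (\<lambda>i k. M $$ (i, k)) u)
      < K * (q * ip {..<n} u u - (ip {..<n} (($) v) u)\<^sup>2) + \<delta> / q\<^sup>2 * (ip {..<n} (($) v) u)\<^sup>2"
    by blast
  define K where "K = (\<Sum>M\<in>\<M>. \<bar>K0 M\<bar>)"
  have K: "K \<ge> K0 M" if "M \<in> \<M>" for M
    using member_le_sum[OF that, of "\<lambda>M. \<bar>K0 M\<bar>"] fin by (auto simp: K_def)
  define A where "A = mat n n (\<lambda>(i, k).
    K * ((if i = k then q else 0) - v $ i * v $ k) + \<delta> / q\<^sup>2 * (v $ i * v $ k))"
  have A_sym: "A \<in> sym_mats n"
    unfolding A_def sym_mats_def by (auto intro!: eq_matI simp: mult.commute)
  have A_app: "app {..<n} (\<lambda>i k. A $$ (i, k)) u i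
      = K * (q * u i - ip {..<n} (($) v) u * v $ i) + \<delta> / q\<^sup>2 * ip {..<n} (($) v) u * v $ i"
    if "i < n" for u i
  proof -
    have "app {..<n} (\<lambda>i k. A $$ (i, k)) u i = (\<Sum>k<n. K * q * (if i = k then u k else 0)
        + (\<delta> / q\<^sup>2 - K) * v $ i * (v $ k * u k))"
      unfolding app_def ip_def by (rule sum.cong) (use that in \<open>auto simp: A_def algebra_simps\<close>)
    also have "\<dots> = K * q * u i + (\<delta> / q\<^sup>2 - K) * v $ i * ip {..<n} (($) v) u"
      unfolding sum.distrib sum_distrib_left[symmetric] ip_def using that by simp
    finally show ?thesis by (simp add: algebra_simps)
  qed
  have A_form: "ip {..<n} u (app {..<n} (\<lambda>i k. A $$ (i, k)) u)
      = K * (q * ip {..<n} u u - (ip {..<n} (($) v) u)\<^sup>2) + \<delta> / q\<^sup>2 * (ip {..<n} (($) v) u)\<^sup>2"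
    for u
  proof -
    have "ip {..<n} u (app {..<n} (\<lambda>i k. A $$ (i, k)) u)
        = ip {..<n} u (\<lambda>i. K * q * u i + (\<delta> / q\<^sup>2 - K) * ip {..<n} (($) v) u * v $ i)"
      by (rule ip_cong) (simp_all add: A_app algebra_simps)
    also have "\<dots> = K * q * ip {..<n} u u
        + (\<delta> / q\<^sup>2 - K) * ip {..<n} (($) v) u * ip {..<n} u (($) v)"
      by (simp add: ip_add_right ip_scale_right)
    finally show ?thesis
      by (simp add: ip_commute[of "{..<n}" u "($) v"] power2_eq_square algebra_simps)
  qed
  show thesis
  proof
    show "A \<in> sym_mats n" by (rule A_sym)
    show "v \<bullet> (A *\<^sub>v v) = \<delta>"
    proof -
      have "A \<in> carrier_mat n n" using A_sym by (simp add: sym_mats_def)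
      from quadratic_form_ip[OF this v(1)] have "v \<bullet> (A *\<^sub>v v) = K * (q * q - q\<^sup>2) + \<delta> / q\<^sup>2 * q\<^sup>2"
        unfolding A_form unfolding q_def .
      then show ?thesis using q by (simp add: power2_eq_square)
    qed
    fix M assume M: "M \<in> \<M>"
    have carr: "A \<in> carrier_mat n n" "M \<in> carrier_mat n n" "transpose_mat A = A" "transpose_mat M = M"
      using A_sym sym[OF M] by (auto simp: sym_mats_def)
    show "pos_def n (A - M)"
      unfolding pos_def_def
    proof (intro conjI ballI impI)
      show "A - M \<in> sym_mats n"
        unfolding sym_mats_def using transpose_minus[OF carr(1,2)] carr minus_carrier_mat[OF carr(2)] by simp
      fix u :: "real vec" assume u: "u \<in> carrier_vec n" "u \<noteq> 0\<^sub>v n"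
      then have "\<exists>i\<in>{..<n}. u $ i \<noteq> 0" by (rule nonzero_vec_entry)
      from K0[of M K "($) u", OF M K[OF M] this]
      have "u \<bullet> (M *\<^sub>v u) < u \<bullet> (A *\<^sub>v u)"
        unfolding quadratic_form_ip[OF carr(1) u(1)] quadratic_form_ip[OF carr(2) u(1)] A_form .
      then show "0 < u \<bullet> ((A - M) *\<^sub>v u)"
        unfolding quadratic_form_minus[OF carr(1,2) u(1)] by simp
    qed
  qed
qed

section \<open>Positive semidefinite kernels\<close>

definition psd_kernel :: "'i set \<Rightarrow> ('i \<Rightarrow> 'i \<Rightarrow> real) \<Rightarrow> bool" where
  "psd_kernel S Q \<longleftrightarrow> (\<forall>a\<in>S. \<forall>b\<in>S. Q a b = Q b a) \<and> (\<forall>x. 0 \<le> ip S x (app S Q x))"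

lemma form_insert:
  assumes "finite S" "s \<notin> S" "\<And>a b. a \<in> insert s S \<Longrightarrow> b \<in> insert s S \<Longrightarrow> Q a b = Q b a"
  shows "ip (insert s S) x (app (insert s S) Q x)
    = Q s s * (x s)\<^sup>2 + 2 * x s * ip S (Q s) x + ip S x (app S Q x)"
proof -
  have "ip S x (app (insert s S) Q x) = ip S x (\<lambda>a. x s * Q s a + app S Q x a)"
    by (rule ip_cong) (use assms in \<open>auto simp: app_def ip_def\<close>)
  then have "ip S x (app (insert s S) Q x) = x s * ip S (Q s) x + ip S x (app S Q x)"
    by (simp add: ip_add_right ip_scale_right ip_commute[of S x "Q s"])
  moreover have "ip (insert s S) u v = u s * v s + ip S u v" for u v
    using assms(1,2) by (simp add: ip_def)
  ultimately show ?thesis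
    by (simp add: app_def power2_eq_square algebra_simps)
qed

text \<open>
  Elimination of one index at a time: subtract the rank one kernel that clears the row of \<open>s\<close>,
  and factorize the Schur complement.
\<close>

lemma psd_decomposition:
  assumes "finite S" "psd_kernel S Q"
  shows "\<exists>c. \<forall>a\<in>S. \<forall>b\<in>S. Q a b = (\<Sum>i\<in>S. c i a * c i b)"
  using assms
proof (induction S arbitrary: Q rule: finite_induct)
  case (insert s S)
  have sym: "Q a b = Q b a" if "a \<in> insert s S" "b \<in> insert s S" for a b
    using insert.prems that by (auto simp: psd_kernel_def)
  have form: "ip (insert s S) x (app (insert s S) Q x)
      = Q s s * (x s)\<^sup>2 + 2 * x s * ip S (Q s) x + ip S x (app S Q x)" for x
    by (rule form_insert[OF insert.hyps]) (rule sym)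
  have nonneg: "0 \<le> Q s s * (x s)\<^sup>2 + 2 * x s * ip S (Q s) x + ip S x (app S Q x)" for x
    using insert.prems unfolding psd_kernel_def form by blast
  have upd: "ip S u (x(s := t)) = ip S u x" "ip S (x(s := t)) u = ip S x u" for u x t
    using insert.hyps by (auto intro!: ip_cong)
  have appupd: "app S Q (x(s := t)) = app S Q x" for x t
    using insert.hyps by (auto intro!: app_cong)
  have quad: "0 \<le> Q s s * t\<^sup>2 + 2 * t * ip S (Q s) x + ip S x (app S Q x)" for t x
    using nonneg[of "x(s := t)"] by (simp add: upd appupd)
  \<comment> \<open>The Schur complement of the entry at \<open>s\<close>; it is \<open>Q\<close> itself if that entry vanishes.\<close>
  define Q' where "Q' = (\<lambda>a b. Q a b - Q s a * Q s b / Q s s)"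
  have diag: "0 \<le> Q s s"
    using quad[of 1 "\<lambda>_. 0"] by (simp add: ip_def)
  have zero: "ip S (Q s) x = 0" if "Q s s = 0" for x
  proof (rule ccontr)
    define \<beta> \<gamma> where "\<beta> = ip S (Q s) x" and "\<gamma> = ip S x (app S Q x)"
    assume "ip S (Q s) x \<noteq> 0"
    then have "\<beta> \<noteq> 0" by (simp add: \<beta>_def)
    have "0 \<le> 2 * (- (\<gamma> + 1) / (2 * \<beta>)) * \<beta> + \<gamma>"
      using quad[of "- (\<gamma> + 1) / (2 * \<beta>)" x] that by (simp add: \<beta>_def \<gamma>_def)
    then show False using \<open>\<beta> \<noteq> 0\<close> by (simp add: field_simps)
  qed
  have zero_entry: "Q s a = 0" if "Q s s = 0" "a \<in> insert s S" for a
  proof (cases "a = s")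
    case False
    with that have "ip S (Q s) (\<lambda>b. if b = a then 1 else 0) = Q s a"
      using insert.hyps by (simp add: ip_def if_distrib cong: if_cong)
    with zero[OF that(1)] show ?thesis by simp
  qed (use that in simp)
  have "psd_kernel S Q'"
    unfolding psd_kernel_def
  proof (intro conjI ballI allI)
    fix x
    have "app S Q' x = (\<lambda>a. app S Q x a + (- (ip S (Q s) x / Q s s)) * Q s a)"
      by (auto simp: app_def Q'_def ip_def sum_subtractf sum_distrib_left sum_divide_distrib
          algebra_simps)
    then have "ip S x (app S Q' x) = ip S x (app S Q x) + (- (ip S (Q s) x / Q s s)) * ip S x (Q s)"
      by (simp only: ip_add_right ip_scale_right)
    then have "ip S x (app S Q' x) = ip S x (app S Q x) - (ip S (Q s) x)\<^sup>2 / Q s s"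
      by (simp add: ip_commute[of S x "Q s"] power2_eq_square)
    also have "\<dots> \<ge> 0"
    proof (cases "Q s s = 0")
      case True
      then show ?thesis using quad[of 0 x] by simp
    next
      case False
      then show ?thesis
        using quad[of "- ip S (Q s) x / Q s s" x] diag
        by (simp add: power2_eq_square field_simps)
    qed
    finally show "0 \<le> ip S x (app S Q' x)" .
  qed (use sym in \<open>simp add: Q'_def\<close>)
  then obtain c where c: "\<And>a b. a \<in> S \<Longrightarrow> b \<in> S \<Longrightarrow> Q' a b = (\<Sum>i\<in>S. c i a * c i b)"
    using insert.IH by blast
  define c' where "c' = (\<lambda>i a. if i = s then Q s a / sqrt (Q s s) else if a = s then 0 else c i a)"
  have "Q a b = (\<Sum>i\<in>insert s S. c' i a * c' i b)" if ab: "a \<in> insert s S" "b \<in> insert s S" for a b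
  proof -
    have "(\<Sum>i\<in>S. c' i a * c' i b) = (if a = s \<or> b = s then 0 else Q' a b)"
    proof (cases "a = s \<or> b = s")
      case False
      then have "(\<Sum>i\<in>S. c' i a * c' i b) = (\<Sum>i\<in>S. c i a * c i b)"
        using insert.hyps by (intro sum.cong) (auto simp: c'_def)
      with False ab c show ?thesis by auto
    qed (use insert.hyps in \<open>auto simp: c'_def intro!: sum.neutral\<close>)
    then have "(\<Sum>i\<in>insert s S. c' i a * c' i b)
        = Q s a * Q s b / Q s s + (if a = s \<or> b = s then 0 else Q' a b)"
      using insert.hyps diag by (simp add: c'_def)
    also have "\<dots> = Q a b"
      using zero_entry ab sym by (cases "Q s s = 0") (auto simp: Q'_def)
    finally show ?thesis by simp
  qed
  then show ?case by blast
qed simp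

text \<open>
  The inverse of a positive definite kernel comes in the factorized form \<open>E\<^sup>T E\<close>: if \<open>\<Delta>\<close> inverts
  \<open>\<Gamma>\<close> on \<open>S\<close> and \<open>\<Gamma> z\<close> vanishes on \<open>S\<close>, then \<open>\<Delta> + z z\<^sup>T / (z \<bullet> \<Gamma> z)\<close> inverts it on
  \<open>insert s S\<close>.
\<close>

lemma inverse_of_positive_definite:
  assumes "finite S" "\<And>a b. a \<in> S \<Longrightarrow> b \<in> S \<Longrightarrow> \<Gamma> a b = \<Gamma> b a"
    and "\<And>x. \<exists>i\<in>S. x i \<noteq> 0 \<Longrightarrow> 0 < ip S x (app S \<Gamma> x)"
  shows "\<exists>E. \<forall>u\<in>S. \<forall>v\<in>S.
    (\<Sum>w\<in>S. \<Gamma> u w * (\<Sum>i\<in>S. E i w * E i v)) = (if u = v then 1 else 0)"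
  using assms
proof (induction S rule: finite_induct)
  case (insert s S)
  note sym = insert.prems(1) and pos = insert.prems(2)
  have form: "ip (insert s S) x (app (insert s S) \<Gamma> x)
      = \<Gamma> s s * (x s)\<^sup>2 + 2 * x s * ip S (\<Gamma> s) x + ip S x (app S \<Gamma> x)" for x
    by (rule form_insert[OF insert.hyps]) (rule sym)
  have upd: "ip S u (x(s := t)) = ip S u x" "ip S (x(s := t)) u = ip S x u" for u x t
    using insert.hyps by (auto intro!: ip_cong)
  have appupd: "app S \<Gamma> (x(s := t)) = app S \<Gamma> x" for x t
    using insert.hyps by (auto intro!: app_cong)
  have "0 < ip S x (app S \<Gamma> x)" if "\<exists>i\<in>S. x i \<noteq> 0" for x
  proof -
    have "\<exists>i\<in>insert s S. (x(s := 0)) i \<noteq> 0" using that insert.hyps by auto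
    from pos[OF this] show ?thesis unfolding form upd appupd by simp
  qed
  from insert.IH[OF _ this] sym obtain E where E: "\<And>u v. u \<in> S \<Longrightarrow> v \<in> S \<Longrightarrow>
      (\<Sum>w\<in>S. \<Gamma> u w * (\<Sum>i\<in>S. E i w * E i v)) = (if u = v then 1 else 0)"
    by blast
  define \<Delta> where "\<Delta> = (\<lambda>w v. \<Sum>i\<in>S. E i w * E i v)"
  have \<Delta>: "(\<Sum>w\<in>S. \<Gamma> u w * \<Delta> w v) = (if u = v then 1 else 0)" if "u \<in> S" "v \<in> S" for u v
    using E[OF that] by (simp add: \<Delta>_def)
  have \<Delta>_sym: "\<Delta> w v = \<Delta> v w" for w v by (simp add: \<Delta>_def mult.commute)
  \<comment> \<open>The vector that \<open>\<Gamma>\<close> sends to a multiple of the unit vector at \<open>s\<close>.\<close>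
  define z where "z = (\<lambda>w. if w = s then 1 else - (\<Sum>v\<in>S. \<Delta> w v * \<Gamma> v s))"
  define \<eta> where "\<eta> = ip (insert s S) z (app (insert s S) \<Gamma> z)"
  have z_S: "app (insert s S) \<Gamma> z u = 0" if u: "u \<in> S" for u
  proof -
    have "(\<Sum>w\<in>S. \<Gamma> u w * z w) = - (\<Sum>w\<in>S. \<Sum>v\<in>S. \<Gamma> u w * \<Delta> w v * \<Gamma> v s)"
      unfolding sum_negf[symmetric] using insert.hyps
      by (intro sum.cong) (auto simp: z_def sum_distrib_left mult.assoc sum_negf)
    also have "\<dots> = - (\<Sum>v\<in>S. (\<Sum>w\<in>S. \<Gamma> u w * \<Delta> w v) * \<Gamma> v s)"
      unfolding sum_distrib_right by (subst sum.swap) simp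
    also have "\<dots> = - (\<Sum>v\<in>S. (if v = u then \<Gamma> u s else 0))"
      using u by (intro arg_cong[where f = uminus] sum.cong) (auto simp: \<Delta>)
    also have "\<dots> = - \<Gamma> u s" using u insert.hyps by simp
    finally show ?thesis using insert.hyps by (simp add: app_def ip_def z_def)
  qed
  have ipins: "ip (insert s S) u v = u s * v s + ip S u v" for u v
    using insert.hyps by (simp add: ip_def)
  have "ip S z (app (insert s S) \<Gamma> z) = ip S z (\<lambda>_. 0)"
    by (rule ip_cong) (use z_S in auto)
  then have \<eta>_eq: "app (insert s S) \<Gamma> z s = \<eta>"
    unfolding \<eta>_def ipins by (simp add: ip_def z_def)
  have \<eta>_pos: "0 < \<eta>"
    unfolding \<eta>_def by (rule pos) (auto simp: z_def intro: bexI[of _ s])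
  define E' where "E' = (\<lambda>i w. if i = s then z w / sqrt \<eta> else if w = s then 0 else E i w)"
  have "(\<Sum>w\<in>insert s S. \<Gamma> u w * (\<Sum>i\<in>insert s S. E' i w * E' i v)) = (if u = v then 1 else 0)"
    if uv: "u \<in> insert s S" "v \<in> insert s S" for u v
  proof -
    have inner: "(\<Sum>i\<in>insert s S. E' i w * E' i v)
        = z w * z v / \<eta> + (if w = s \<or> v = s then 0 else \<Delta> w v)" for w
    proof -
      have "(\<Sum>i\<in>S. E' i w * E' i v) = (if w = s \<or> v = s then 0 else \<Delta> w v)"
        unfolding \<Delta>_def using insert.hyps
        by (auto simp: E'_def intro!: sum.cong sum.neutral)
      then show ?thesis using insert.hyps \<eta>_pos by (simp add: E'_def)
    qed
    have "(\<Sum>w\<in>insert s S. \<Gamma> u w * (if w = s \<or> v = s then 0 else \<Delta> w v))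
        = (if v = s then 0 else \<Sum>w\<in>S. \<Gamma> u w * \<Delta> w v)"
      using insert.hyps by (auto intro!: sum.cong)
    moreover have "(\<Sum>w\<in>insert s S. \<Gamma> u w * (z w * z v / \<eta>))
        = app (insert s S) \<Gamma> z u * (z v / \<eta>)"
      unfolding app_def ip_def sum_distrib_right by (intro sum.cong) simp_all
    ultimately have eq: "(\<Sum>w\<in>insert s S. \<Gamma> u w * (\<Sum>i\<in>insert s S. E' i w * E' i v))
        = app (insert s S) \<Gamma> z u * (z v / \<eta>) + (if v = s then 0 else \<Sum>w\<in>S. \<Gamma> u w * \<Delta> w v)"
      unfolding inner distrib_left sum.distrib by simp
    show ?thesis
    proof (cases "u = s")
      case False
      then have "u \<in> S" using uv by simp
      then show ?thesis unfolding eq using uv \<Delta> z_S insert.hyps by auto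
    next
      case True
      have "(\<Sum>w\<in>S. \<Gamma> s w * \<Delta> w v) = (\<Sum>w\<in>S. \<Delta> v w * \<Gamma> w s)"
        by (rule sum.cong) (use sym \<Delta>_sym in auto)
      then show ?thesis
        unfolding eq unfolding True \<eta>_eq using uv \<eta>_pos by (auto simp: z_def)
    qed
  qed
  then show ?case by blast
qed simp

section \<open>The truncated Fock representation\<close>

definition words :: "nat \<Rightarrow> 'g list set" where
  "words d = {w. length w \<le> d}"

lemma finite_words [simp]: "finite (words d :: ('g::finite) list set)"
  using finite_lists_length_le[of "UNIV :: 'g set" d] by (simp add: words_def)

text \<open>
  The sum of the creation operator of the letter \<open>a\<close>, which puts \<open>a\<close> in front of a word, and its
  adjoint.
\<close>

definition fock :: "'g \<Rightarrow> 'g list \<Rightarrow> 'g list \<Rightarrow> real" where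
  "fock a u k = (if u = a # k \<or> k = a # u then 1 else 0)"

definition vacuum :: "'g list \<Rightarrow> real" where
  "vacuum u = (if u = [] then 1 else 0)"

lemma symmetric_kernels_fock: "symmetric_kernels I fock"
  by (auto simp: symmetric_kernels_def fock_def)

text \<open>
  Acting by \<open>w\<close> on the vacuum gives \<open>w\<close> plus shorter words: a word as long as \<open>w\<close> is only reached
  by creating at every step.
\<close>

lemma act_fock_leading:
  fixes u :: "('g::finite) list"
  assumes "u \<in> words d" "length w \<le> length u"
  shows "act (words d) fock w vacuum u = (if u = w then 1 else 0)"
  using assms
proof (induction w arbitrary: u)
  case (Cons a w)
  have summand: "fock a u k * act (words d) fock w vacuum k
      = (if k = w then if u = a # w then 1 else 0 else 0)" if "k \<in> words d" for k
  proof (cases "u = a # k \<or> k = a # u")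
    case True
    with Cons.prems have "length w \<le> length k" "k = a # u \<Longrightarrow> k \<noteq> w" by auto
    with Cons.IH[OF that] True show ?thesis by (auto simp: fock_def[of a u k])
  next
    case False
    then show ?thesis by (auto simp: fock_def[of a u k])
  qed
  have "act (words d) fock (a # w) vacuum u
      = (\<Sum>k\<in>words d. if k = w then if u = a # w then 1 else 0 else 0)"
    by (simp add: app_def ip_def summand cong: sum.cong)
  also have "\<dots> = (if u = a # w then 1 else 0)"
  proof (cases "u = a # w")
    case True
    then have "w \<in> words d" using Cons.prems by (simp add: words_def)
    with True show ?thesis by simp
  qed simp
  finally show ?case .
qed (simp add: vacuum_def)

text \<open>
  The vectors \<open>m(F) \<Omega>\<close> are triangular with respect to the length of words, so functionals with
  prescribed values on them are found by recursion on the length.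
\<close>

lemma fock_dual_functional:
  fixes y :: "('g::finite) list \<Rightarrow> real"
  shows "\<exists>k. \<forall>m\<in>words d. ip (words d) k (act (words d) fock m vacuum) = y m"
proof -
  have "\<exists>k. \<forall>m. length m < n \<longrightarrow> ip (words d) k (act (words d) fock m vacuum) = y m"
    if "n \<le> Suc d" for n
    using that
  proof (induction n)
    case (Suc n)
    then obtain k where k: "\<And>m. length m < n \<Longrightarrow>
        ip (words d) k (act (words d) fock m vacuum) = y m" by auto
    define r where "r = (\<lambda>m. if length m = n
      then y m - ip (words d) k (act (words d) fock m vacuum) else 0)"
    have r: "ip (words d) r (act (words d) fock m vacuum) = r m" if "length m \<le> n" for m
    proof -
      have "ip (words d) r (act (words d) fock m vacuum)
          = (\<Sum>u\<in>words d. if u = m then r m else 0)"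
        unfolding ip_def
      proof (rule sum.cong)
        fix u :: "'g list" assume u: "u \<in> words d"
        show "r u * act (words d) fock m vacuum u = (if u = m then r m else 0)"
          using act_fock_leading[OF u, of m] that by (cases "length u = n") (auto simp: r_def)
      qed simp
      also have "\<dots> = r m"
      proof -
        have "m \<in> words d" using that Suc.prems by (simp add: words_def)
        then show ?thesis by simp
      qed
      finally show ?thesis .
    qed
    have "ip (words d) (\<lambda>u. k u + r u) (act (words d) fock m vacuum) = y m"
      if "length m < Suc n" for m
      using that r[of m] k[of m] by (cases "length m = n") (auto simp: ip_add_left r_def)
    then show ?case by blast
  qed simp
  from this[of "Suc d"] show ?thesis by (auto simp: words_def less_Suc_eq_le)
qed

text \<open>
  A quantitative form of linear independence: the dual functionals recover the coefficients of
  \<open>h\<close> from the vector \<open>h(F) \<Omega>\<close>.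
\<close>

lemma fock_lower_bound:
  "\<exists>C\<ge>0. \<forall>c :: ('g::finite) list \<Rightarrow> real.
    (\<Sum>u\<in>words d. (c u)\<^sup>2) \<le>
      C * ip (words d) (\<lambda>i. \<Sum>w\<in>words d. c w * act (words d) fock w vacuum i)
                       (\<lambda>i. \<Sum>w\<in>words d. c w * act (words d) fock w vacuum i)"
proof -
  let ?W = "words d :: 'g list set"
  have "\<forall>u. \<exists>k. \<forall>m\<in>?W. ip ?W k (act ?W fock m vacuum) = (if m = u then 1 else 0)"
    by (intro allI fock_dual_functional)
  then obtain k where k: "\<And>u m. m \<in> ?W \<Longrightarrow>
      ip ?W (k u) (act ?W fock m vacuum) = (if m = u then 1 else 0)" by metis
  have "(\<Sum>u\<in>?W. (c u)\<^sup>2) \<le> (\<Sum>u\<in>?W. ip ?W (k u) (k u)) * ip ?W y y"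
    if y: "y = (\<lambda>i. \<Sum>w\<in>?W. c w * act ?W fock w vacuum i)" for c y
  proof -
    have "c u = ip ?W (k u) y" if "u \<in> ?W" for u
      using that by (simp add: y ip_sum_right ip_scale_right k if_distrib cong: sum.cong if_cong)
    then have "(\<Sum>u\<in>?W. (c u)\<^sup>2) = (\<Sum>u\<in>?W. (ip ?W (k u) y)\<^sup>2)" by simp
    also have "\<dots> \<le> (\<Sum>u\<in>?W. ip ?W (k u) (k u) * ip ?W y y)"
      by (intro sum_mono ip_cauchy_schwarz) simp
    finally show ?thesis by (simp add: sum_distrib_right)
  qed
  moreover have "0 \<le> (\<Sum>u\<in>?W. ip ?W (k u) (k u))" by (intro sum_nonneg ip_self_nonneg)
  ultimately show ?thesis by blast
qed

section \<open>Positive functionals are vector states\<close>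

text \<open>
  The Gelfand-Naimark-Segal construction in finite dimension. Here \<open>\<Gamma>\<close> is the Gram matrix of the
  words of length at most \<open>d\<close> in the inner product \<open>\<langle>p, q\<rangle> = L(p\<^sup>* q)\<close>. With \<open>\<Gamma>\<^sup>-\<^sup>1 = E\<^sup>T E\<close> the vectors
  \<open>C u = E \<Gamma> e\<^sub>u\<close> realize the word \<open>u\<close> in an orthonormal basis, and
  \<open>X\<^sub>a = E (L(u\<^sup>* a v))\<^sub>u\<^sub>v E\<^sup>T\<close> is multiplication by \<open>a\<close> compressed to words of length at
  most \<open>d\<close>. Words of length up to \<open>2 d\<close> are reached by moving half of the letters to the left of
  the inner product.
\<close>

lemma positive_functional_is_vector_state:
  fixes L :: "('g::finite) list \<Rightarrow> real"
  assumes rev: "\<And>w. L (rev w) = L w"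
    and pos: "\<And>x. \<exists>u\<in>words d. x u \<noteq> 0 \<Longrightarrow>
      0 < ip (words d) x (app (words d) (\<lambda>u v. L (rev u @ v)) x)"
  shows "\<exists>X v. symmetric_kernels (words d :: 'g list set) X \<and>
    (\<forall>w\<in>words (2 * d). ip (words d) v (act (words d) X w v) = L w)"
proof -
  let ?W = "words d :: 'g list set"
  define \<Gamma> where "\<Gamma> = (\<lambda>u v. L (rev u @ v))"
  have sym: "\<Gamma> u v = \<Gamma> v u" for u v
    using rev[of "rev u @ v"] by (simp add: \<Gamma>_def)
  have "\<exists>E. \<forall>u\<in>?W. \<forall>v\<in>?W.
      (\<Sum>w\<in>?W. \<Gamma> u w * (\<Sum>i\<in>?W. E i w * E i v)) = (if u = v then 1 else 0)"
    by (rule inverse_of_positive_definite) (use sym pos in \<open>auto simp: \<Gamma>_def\<close>)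
  then obtain E where E: "\<And>u v. u \<in> ?W \<Longrightarrow> v \<in> ?W \<Longrightarrow>
      (\<Sum>w\<in>?W. \<Gamma> u w * (\<Sum>i\<in>?W. E i w * E i v)) = (if u = v then 1 else 0)"
    by blast
  define C where "C = (\<lambda>u i. \<Sum>w\<in>?W. \<Gamma> u w * E i w)"
  have CE: "(\<Sum>i\<in>?W. C u i * E i v) = (if u = v then 1 else 0)" if "u \<in> ?W" "v \<in> ?W" for u v
  proof -
    have "(\<Sum>i\<in>?W. C u i * E i v) = (\<Sum>w\<in>?W. \<Sum>i\<in>?W. \<Gamma> u w * (E i w * E i v))"
      unfolding C_def sum_distrib_right mult.assoc by (rule sum.swap)
    then show ?thesis using E[OF that] by (simp add: sum_distrib_left)
  qed
  have Gram: "ip ?W (C u) (C v) = \<Gamma> u v" if "u \<in> ?W" for u v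
  proof -
    have "ip ?W (C u) (C v) = (\<Sum>w\<in>?W. \<Gamma> v w * (\<Sum>i\<in>?W. C u i * E i w))"
      unfolding C_def[THEN fun_cong, of v] ip_sum_right ip_scale_right by (simp add: ip_def)
    also have "\<dots> = (\<Sum>w\<in>?W. \<Gamma> v w * (if u = w then 1 else 0))"
      using CE[OF that] by simp
    also have "\<dots> = \<Gamma> v u" using that by (simp add: if_distrib cong: if_cong)
    finally show ?thesis by (simp add: sym)
  qed
  define X where "X = (\<lambda>a i k. \<Sum>u\<in>?W. \<Sum>v\<in>?W. E i u * L (rev u @ a # v) * E k v)"
  have Lsym: "L (rev u @ a # v) = L (rev v @ a # u)" for u v a
    using rev[of "rev u @ a # v"] by simp
  have Xsym: "symmetric_kernels ?W X"
    unfolding symmetric_kernels_def X_def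
  proof (intro allI ballI)
    fix a and i k :: "'g list"
    have "(\<Sum>u\<in>?W. \<Sum>v\<in>?W. E i u * L (rev u @ a # v) * E k v)
        = (\<Sum>v\<in>?W. \<Sum>u\<in>?W. E i u * L (rev u @ a # v) * E k v)" by (rule sum.swap)
    also have "\<dots> = (\<Sum>v\<in>?W. \<Sum>u\<in>?W. E k v * L (rev v @ a # u) * E i u)"
    proof (intro sum.cong refl)
      fix u v :: "'g list"
      show "E i u * L (rev u @ a # v) * E k v = E k v * L (rev v @ a # u) * E i u"
        using Lsym[of u a v] by simp
    qed
    finally show "(\<Sum>u\<in>?W. \<Sum>v\<in>?W. E i u * L (rev u @ a # v) * E k v)
      = (\<Sum>u\<in>?W. \<Sum>v\<in>?W. E k u * L (rev u @ a # v) * E i v)" .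
  qed
  have XC: "app ?W (X a) (C w) = C (a # w)" if "w \<in> ?W" for a w
  proof
    fix i
    have "app ?W (X a) (C w) i
        = (\<Sum>k\<in>?W. \<Sum>u\<in>?W. \<Sum>v\<in>?W. E i u * L (rev u @ a # v) * (C w k * E k v))"
      by (simp add: app_def ip_def X_def sum_distrib_left sum_distrib_right mult_ac)
    also have "\<dots> = (\<Sum>u\<in>?W. \<Sum>k\<in>?W. \<Sum>v\<in>?W. E i u * L (rev u @ a # v) * (C w k * E k v))"
      by (rule sum.swap)
    also have "\<dots> = (\<Sum>u\<in>?W. \<Sum>v\<in>?W. \<Sum>k\<in>?W. E i u * L (rev u @ a # v) * (C w k * E k v))"
      by (intro sum.cong refl sum.swap)
    also have "\<dots> = (\<Sum>u\<in>?W. \<Sum>v\<in>?W. E i u * L (rev u @ a # v) * (if w = v then 1 else 0))"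
      unfolding sum_distrib_left[symmetric] using CE that by simp
    also have "\<dots> = (\<Sum>u\<in>?W. E i u * L (rev u @ a # w))"
      using that by (simp add: if_distrib cong: if_cong)
    also have "\<dots> = C (a # w) i"
      unfolding C_def by (intro sum.cong refl) (simp add: sym[of "a # w"], simp add: \<Gamma>_def)
    finally show "app ?W (X a) (C w) i = C (a # w) i" .
  qed
  have act: "act ?W X w (C []) = C w" if "w \<in> ?W" for w
    using that
  proof (induction w)
    case (Cons a w)
    then have "w \<in> ?W" by (simp add: words_def)
    with Cons.IH show ?case by (simp add: XC)
  qed simp
  have "ip ?W (C []) (act ?W X w (C [])) = L w" if "w \<in> words (2 * d)" for w
  proof -
    define u v where "u = rev (take d w)" and "v = drop d w"
    have uv: "u \<in> ?W" "v \<in> ?W" "w = rev u @ v"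
      using that by (auto simp: u_def v_def words_def)
    have "ip ?W (C []) (act ?W X w (C [])) = ip ?W (act ?W X u (C [])) (act ?W X v (C []))"
      unfolding uv(3) act_append by (simp add: ip_act_rev[OF Xsym])
    also have "\<dots> = L w" using uv by (simp add: act Gram) (simp add: \<Gamma>_def)
    finally show ?thesis .
  qed
  with Xsym show ?thesis by blast
qed

section \<open>Nowhere negative polynomials are sums of squares\<close>

lemma sum_of_squares_finite_sum:
  assumes "finite A"
  shows "sum_of_squares (\<Sum>i\<in>A. adjoint_poly (h i) * h i)"
proof -
  obtain e where "bij_betw e {0..<card A} A"
    using ex_bij_betw_nat_finite[OF assms] by blast
  from sum.reindex_bij_betw[OF this, of "\<lambda>i. adjoint_poly (h i) * h i"]
  show ?thesis
    unfolding sum_of_squares_def lessThan_atLeast0 by metis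
qed

lemma psd_kernel_entry_le_trace:
  assumes "finite S" "psd_kernel S Q" "a \<in> S" "b \<in> S"
  shows "\<bar>Q a b\<bar> \<le> (\<Sum>u\<in>S. Q u u)"
proof -
  obtain c where c: "\<And>a b. a \<in> S \<Longrightarrow> b \<in> S \<Longrightarrow> Q a b = (\<Sum>i\<in>S. c i a * c i b)"
    using psd_decomposition[OF assms(1,2)] by blast
  have diag: "Q u u \<ge> 0" if "u \<in> S" for u
    using c[OF that that] by (simp add: sum_nonneg)
  have bound: "\<bar>x * y\<bar> \<le> (x * x + y * y) / 2" for x y :: real
  proof -
    have "0 \<le> (\<bar>x\<bar> - \<bar>y\<bar>)\<^sup>2" by simp
    then show ?thesis by (simp add: power2_eq_square algebra_simps abs_mult)
  qed
  have "\<bar>Q a b\<bar> \<le> (\<Sum>i\<in>S. \<bar>c i a * c i b\<bar>)" using c assms by simp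
  also have "\<dots> \<le> (\<Sum>i\<in>S. (c i a * c i a + c i b * c i b) / 2)"
    by (intro sum_mono bound)
  also have "\<dots> = (Q a a + Q b b) / 2"
    using c assms by (simp add: sum.distrib sum_divide_distrib[symmetric])
  also have "\<dots> \<le> (\<Sum>u\<in>S. Q u u)"
    using member_le_sum[of a S "\<lambda>u. Q u u"] member_le_sum[of b S "\<lambda>u. Q u u"] diag assms
    by auto
  finally show ?thesis .
qed

text \<open>
  Tychonoff: boxes are compact in the product topology.
\<close>

lemma continuous_attains_inf_box:
  fixes F :: "('a \<Rightarrow> real) \<Rightarrow> real"
  assumes "closed K" "K \<noteq> {}" "\<And>x i. x \<in> K \<Longrightarrow> \<bar>x i\<bar> \<le> B i" "continuous_on UNIV F"
  shows "\<exists>x\<in>K. \<forall>y\<in>K. F x \<le> F y"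
proof -
  have "compactin (product_topology (\<lambda>i. euclidean) UNIV) (\<Pi>\<^sub>E i\<in>UNIV. {- B i..B i})"
    by (subst compactin_PiE) auto
  then have "compact (\<Pi>\<^sub>E i\<in>UNIV. {- B i..B i})"
    by (simp add: euclidean_product_topology)
  moreover have "K \<subseteq> (\<Pi>\<^sub>E i\<in>UNIV. {- B i..B i})"
    using assms(3) by (auto simp: abs_le_iff minus_le_iff)
  ultimately have "compact K"
    using compact_Int_closed[OF _ assms(1)] by (metis inf.absorb2)
  then show ?thesis
    using continuous_attains_inf[of K F] assms(2,4) continuous_on_subset by blast
qed

text \<open>
  A kernel \<open>S\<close> on words stands for the polynomial \<open>\<Sum> S\<^sub>u\<^sub>v u\<^sup>* v\<close>; \<open>gram_coeff\<close> gives its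
  coefficients, and \<open>pairing\<close> the value of a functional at it. Sums of squares are the
  polynomials of positive semidefinite kernels.
\<close>

definition pairing :: "'g list set \<Rightarrow> ('g list \<Rightarrow> real) \<Rightarrow> ('g list \<times> 'g list \<Rightarrow> real) \<Rightarrow> real" where
  "pairing W L S = (\<Sum>u\<in>W. \<Sum>v\<in>W. S (u, v) * L (rev u @ v))"

definition gram_coeff :: "'g list set \<Rightarrow> ('g list \<times> 'g list \<Rightarrow> real) \<Rightarrow> 'g list \<Rightarrow> real" where
  "gram_coeff W S w = pairing W (\<lambda>u. if u = w then 1 else 0) S"

text \<open>
  A compact set that contains a positive multiple of every positive semidefinite kernel supported
  on \<open>W \<times> W\<close>.
\<close>

definition psd_box :: "'g list set \<Rightarrow> real \<Rightarrow> ('g list \<times> 'g list \<Rightarrow> real) set" where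
  "psd_box W R = {S. (\<forall>p. \<bar>S p\<bar> \<le> (if p \<in> W \<times> W then R else 0)) \<and> psd_kernel W (\<lambda>u v. S (u, v))}"

lemma pairing_add_left: "pairing W (\<lambda>w. L w + M w) S = pairing W L S + pairing W M S"
  by (simp add: pairing_def distrib_left sum.distrib)

lemma pairing_scale_left: "pairing W (\<lambda>w. c * L w) S = c * pairing W L S"
  by (simp add: pairing_def sum_distrib_left mult_ac)

lemma pairing_scale_right: "pairing W L (\<lambda>p. c * S p) = c * pairing W L S"
  by (simp add: pairing_def sum_distrib_left mult_ac)

lemma gram_coeff_line:
  "gram_coeff W (\<lambda>p. S p + t * (T p - S p)) w
    = gram_coeff W S w + t * (gram_coeff W T w - gram_coeff W S w)"
  unfolding gram_coeff_def pairing_def sum_distrib_left sum_subtractf[symmetric] sum.distrib[symmetric]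
  by (intro sum.cong refl) (simp add: algebra_simps)

lemma sum_gram_coeff:
  fixes W :: "'g list set"
  assumes "finite V" "\<And>u v. u \<in> W \<Longrightarrow> v \<in> W \<Longrightarrow> rev u @ v \<in> V"
  shows "(\<Sum>w\<in>V. L w * gram_coeff W S w) = pairing W L S"
proof -
  have "(\<Sum>w\<in>V. L w * gram_coeff W S w)
      = (\<Sum>u\<in>W. \<Sum>v\<in>W. \<Sum>w\<in>V. S (u, v) * (if w = rev u @ v then L w else 0))"
  proof -
    have "(\<Sum>w\<in>V. L w * gram_coeff W S w)
        = (\<Sum>w\<in>V. \<Sum>u\<in>W. \<Sum>v\<in>W. S (u, v) * (if w = rev u @ v then L w else 0))"
      unfolding gram_coeff_def pairing_def sum_distrib_left
      by (intro sum.cong refl) auto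
    also have "\<dots> = (\<Sum>u\<in>W. \<Sum>w\<in>V. \<Sum>v\<in>W. S (u, v) * (if w = rev u @ v then L w else 0))"
      by (rule sum.swap)
    also have "\<dots> = (\<Sum>u\<in>W. \<Sum>v\<in>W. \<Sum>w\<in>V. S (u, v) * (if w = rev u @ v then L w else 0))"
      by (intro sum.cong refl sum.swap)
    finally show ?thesis .
  qed
  also have "\<dots> = pairing W L S"
    unfolding pairing_def sum_distrib_left[symmetric]
    by (intro sum.cong refl) (simp add: assms)
  finally show ?thesis .
qed

lemma gram_coeff_rev:
  assumes "psd_kernel W (\<lambda>u v. S (u, v))"
  shows "gram_coeff W S (rev w) = gram_coeff W S w"
proof -
  have flip: "rev u @ v = rev w \<longleftrightarrow> rev v @ u = w" for u v
    using rev_is_rev_conv[of "rev u @ v" "rev w"] by auto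
  have "gram_coeff W S (rev w)
      = (\<Sum>u\<in>W. \<Sum>v\<in>W. S (u, v) * (if rev v @ u = w then 1 else 0))"
    unfolding gram_coeff_def pairing_def
    by (simp add: flip)
  also have "\<dots> = (\<Sum>v\<in>W. \<Sum>u\<in>W. S (u, v) * (if rev v @ u = w then 1 else 0))"
    by (rule sum.swap)
  also have "\<dots> = gram_coeff W S w"
    unfolding gram_coeff_def pairing_def
    using assms by (intro sum.cong refl) (auto simp: psd_kernel_def)
  finally show ?thesis .
qed

lemma sum_of_squares_if_gram:
  fixes g :: "('g::finite) free_poly"
  assumes "finite W" "psd_kernel W (\<lambda>u v. S (u, v))" "\<And>w. Poly_Mapping.lookup g w = gram_coeff W S w"
  shows "sum_of_squares g"
proof -
  obtain c where c: "\<And>u v. u \<in> W \<Longrightarrow> v \<in> W \<Longrightarrow> S (u, v) = (\<Sum>i\<in>W. c i u * c i v)"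
    using psd_decomposition[OF assms(1,2)] by blast
  define h :: "'g list \<Rightarrow> 'g free_poly" where
    "h = (\<lambda>i. \<Sum>u\<in>W. Poly_Mapping.single u (c i u))"
  have lookup_h: "Poly_Mapping.lookup (h i) u = (if u \<in> W then c i u else 0)" for i u
    using assms(1) by (auto simp: h_def lookup_sum lookup_single when_def)
  have keys: "Poly_Mapping.keys (h i) \<subseteq> W" for i
    by (auto simp: in_keys_iff lookup_h split: if_splits)
  have "g = (\<Sum>i\<in>W. adjoint_poly (h i) * h i)"
  proof (rule poly_mapping_eqI)
    fix w
    have "Poly_Mapping.lookup (\<Sum>i\<in>W. adjoint_poly (h i) * h i) w
        = (\<Sum>i\<in>W. \<Sum>u\<in>W. \<Sum>v\<in>W. c i u * c i v * (if rev u @ v = w then 1 else 0))"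
      unfolding square_as_sum_of_words[OF assms(1) keys] lookup_sum
      by (intro sum.cong refl) (auto simp: lookup_single lookup_h when_def)
    also have "\<dots> = (\<Sum>u\<in>W. \<Sum>i\<in>W. \<Sum>v\<in>W. c i u * c i v * (if rev u @ v = w then 1 else 0))"
      by (rule sum.swap)
    also have "\<dots> = (\<Sum>u\<in>W. \<Sum>v\<in>W. \<Sum>i\<in>W. c i u * c i v * (if rev u @ v = w then 1 else 0))"
      by (intro sum.cong refl sum.swap)
    also have "\<dots> = gram_coeff W S w"
      unfolding gram_coeff_def pairing_def sum_distrib_right[symmetric]
      by (intro sum.cong refl) (simp add: c)
    finally show "Poly_Mapping.lookup g w
        = Poly_Mapping.lookup (\<Sum>i\<in>W. adjoint_poly (h i) * h i) w"
      using assms(3) by simp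
  qed
  then show ?thesis using sum_of_squares_finite_sum[OF assms(1)] by simp
qed

lemma closed_psd_box: "closed (psd_box W R)"
proof -
  have [continuous_intros]: "continuous_on UNIV (\<lambda>S :: 'a list \<times> 'a list \<Rightarrow> real. S p)" for p
    by simp
  have "psd_box W R = (\<Inter>p. {S. \<bar>S p\<bar> \<le> (if p \<in> W \<times> W then R else 0)})
      \<inter> (\<Inter>a\<in>W. \<Inter>b\<in>W. {S. S (a, b) = S (b, a)})
      \<inter> (\<Inter>x. {S. 0 \<le> ip W x (app W (\<lambda>u v. S (u, v)) x)})"
    unfolding psd_box_def psd_kernel_def
    by blast
  then show ?thesis
    by (simp only:)
      (intro closed_Int closed_INT ballI closed_Collect_le closed_Collect_eq,
        simp_all only: ip_def app_def, (intro continuous_intros)+)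
qed

lemma pairing_rank_one:
  "pairing W L (\<lambda>(u, v). x u * x v) = ip W x (app W (\<lambda>u v. L (rev u @ v)) x)"
  by (simp add: pairing_def ip_def app_def sum_distrib_left mult_ac)

lemma psd_kernel_rank_one: "psd_kernel W (\<lambda>u v. x u * x v)"
proof -
  have "ip W y (app W (\<lambda>u v. x u * x v) y) = (ip W x y)\<^sup>2" for y
    by (simp add: app_def ip_def sum_distrib_left sum_distrib_right power2_eq_square mult_ac)
  then show ?thesis by (simp add: psd_kernel_def)
qed

text \<open>
  A functional that is bounded below by the trace of the Gram kernel. Adding a multiple of it turns
  a functional that is almost nonnegative on sums of squares into a positive definite one.
\<close>

lemma trace_le_fock_pairing:
  "\<exists>C\<ge>0. \<forall>S. psd_kernel (words d :: ('g::finite) list set) (\<lambda>u v. S (u, v)) \<longrightarrow>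
    (\<Sum>u\<in>words d. S (u, u)) \<le>
    pairing (words d) (\<lambda>w. C * ip (words d) vacuum (act (words d) fock w vacuum)) S"
proof -
  let ?W = "words d :: 'g list set"
  let ?b = "\<lambda>w. act ?W fock w vacuum"
  obtain C where C: "0 \<le> C" "\<And>c. (\<Sum>u\<in>?W. (c u)\<^sup>2) \<le>
      C * ip ?W (\<lambda>i. \<Sum>w\<in>?W. c w * ?b w i) (\<lambda>i. \<Sum>w\<in>?W. c w * ?b w i)"
    using fock_lower_bound by blast
  have "(\<Sum>u\<in>?W. S (u, u)) \<le> pairing ?W (\<lambda>w. C * ip ?W vacuum (?b w)) S"
    if S: "psd_kernel ?W (\<lambda>u v. S (u, v))" for S
  proof -
    obtain c where c: "\<And>u v. u \<in> ?W \<Longrightarrow> v \<in> ?W \<Longrightarrow> S (u, v) = (\<Sum>i\<in>?W. c i u * c i v)"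
      using psd_decomposition[OF finite_words S] by blast
    have "(\<Sum>u\<in>?W. S (u, u)) = (\<Sum>u\<in>?W. \<Sum>i\<in>?W. (c i u)\<^sup>2)"
      by (simp add: c power2_eq_square)
    also have "\<dots> = (\<Sum>i\<in>?W. \<Sum>u\<in>?W. (c i u)\<^sup>2)" by (rule sum.swap)
    also have "\<dots> \<le> (\<Sum>i\<in>?W. C * ip ?W (\<lambda>k. \<Sum>w\<in>?W. c i w * ?b w k)
        (\<lambda>k. \<Sum>w\<in>?W. c i w * ?b w k))"
      by (intro sum_mono C)
    also have "\<dots> = (\<Sum>i\<in>?W. \<Sum>u\<in>?W. \<Sum>v\<in>?W. c i u * c i v * (C * ip ?W (?b u) (?b v)))"
      by (simp add: ip_sum_left ip_sum_right ip_scale_left ip_scale_right sum_distrib_left mult_ac)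
    also have "\<dots> = (\<Sum>u\<in>?W. \<Sum>i\<in>?W. \<Sum>v\<in>?W. c i u * c i v * (C * ip ?W (?b u) (?b v)))"
      by (rule sum.swap)
    also have "\<dots> = (\<Sum>u\<in>?W. \<Sum>v\<in>?W. \<Sum>i\<in>?W. c i u * c i v * (C * ip ?W (?b u) (?b v)))"
      by (intro sum.cong refl sum.swap)
    also have "\<dots> = (\<Sum>u\<in>?W. \<Sum>v\<in>?W. S (u, v) * (C * ip ?W (?b u) (?b v)))"
      by (intro sum.cong refl) (simp add: c sum_distrib_right)
    also have "\<dots> = pairing ?W (\<lambda>w. C * ip ?W vacuum (?b w)) S"
      unfolding pairing_def act_append
      by (simp add: ip_act_rev[OF symmetric_kernels_fock])
    finally show ?thesis .
  qed
  with C(1) show ?thesis by blast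
qed

text \<open>
  Separation from the cone of sums of squares. The functional is \<open>r = q - g\<close> where \<open>q\<close> is the point
  closest to \<open>g\<close> among the polynomials of the compact set \<open>psd_box W R\<close>. Since this set
  is only part of the cone, \<open>r\<close> may be negative on sums of squares, but by scaling kernels into the
  box the defect is at most \<open>\<nu> / R\<close> times the trace; the value \<open>- \<nu> - \<rho>\<close> at \<open>g\<close>
  outweighs the correction of this defect as long as the correcting functional is at most
  \<open>R\<close> at \<open>g\<close>.
\<close>

lemma separating_functional:
  fixes g :: "'g list \<Rightarrow> real"
  assumes "finite W" "finite V" "\<And>u v. u \<in> W \<Longrightarrow> v \<in> W \<Longrightarrow> rev u @ v \<in> V"
    and not_gram: "\<And>S. psd_kernel W (\<lambda>u v. S (u, v)) \<Longrightarrow> \<exists>w\<in>V. g w \<noteq> gram_coeff W S w"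
    and rev: "\<And>w. g (rev w) = g w" and R: "0 < R"
  obtains r \<nu> \<rho> where "\<And>w. r (rev w) = r w" "0 \<le> \<nu>" "0 < \<rho>"
    "(\<Sum>w\<in>V. r w * g w) = - \<nu> - \<rho>"
    "\<And>S. psd_kernel W (\<lambda>u v. S (u, v)) \<Longrightarrow> - (\<nu> / R) * (\<Sum>u\<in>W. S (u, u)) \<le> pairing W r S"
proof -
  define F where "F = (\<lambda>S. \<Sum>w\<in>V. (gram_coeff W S w - g w)\<^sup>2)"
  have zero: "(\<lambda>_. 0) \<in> psd_box W R"
    using R by (simp add: psd_box_def psd_kernel_def app_def ip_def)
  have cont: "continuous_on UNIV F"
    unfolding F_def gram_coeff_def pairing_def by (intro continuous_intros) simp_all
  have bounded: "\<bar>S p\<bar> \<le> (if p \<in> W \<times> W then R else 0)" if "S \<in> psd_box W R" for S p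
    using that unfolding psd_box_def by blast
  have "\<exists>S0\<in>psd_box W R. \<forall>S\<in>psd_box W R. F S0 \<le> F S"
  proof (rule continuous_attains_inf_box)
    show "\<bar>S p\<bar> \<le> (if p \<in> W \<times> W then R else 0)" if "S \<in> psd_box W R" for S p
      by (rule bounded[OF that])
  qed (use closed_psd_box zero cont in auto)
  then obtain S0 where S0: "S0 \<in> psd_box W R" and min: "\<And>S. S \<in> psd_box W R \<Longrightarrow> F S0 \<le> F S"
    by blast
  have psd0: "psd_kernel W (\<lambda>u v. S0 (u, v))" using S0 by (simp add: psd_box_def)
  define r where "r = (\<lambda>w. gram_coeff W S0 w - g w)"
  have pair: "(\<Sum>w\<in>V. r w * gram_coeff W S w) = pairing W r S" for S
    by (rule sum_gram_coeff) (use assms in auto)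
  \<comment> \<open>The first-order condition at the minimum of a convex function over a convex set.\<close>
  have first_order: "pairing W r S0 \<le> pairing W r S" if S: "S \<in> psd_box W R" for S
  proof (rule ccontr)
    assume "\<not> pairing W r S0 \<le> pairing W r S"
    define \<beta> where "\<beta> = pairing W r S0 - pairing W r S"
    define \<gamma> where "\<gamma> = (\<Sum>w\<in>V. (gram_coeff W S w - gram_coeff W S0 w)\<^sup>2)"
    have \<beta>: "0 < \<beta>" and \<gamma>: "0 \<le> \<gamma>"
      using \<open>\<not> _\<close> by (auto simp: \<beta>_def \<gamma>_def intro: sum_nonneg)
    \<comment> \<open>This step length makes the linear decrease \<open>2 t \<beta>\<close> outweigh the quadratic term \<open>t\<^sup>2 \<gamma>\<close>.\<close>
    define t where "t = min 1 (\<beta> / (\<gamma> + 1))"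
    have t: "0 < t" "t \<le> 1" using \<beta> \<gamma> by (auto simp: t_def)
    have "t \<le> \<beta> / (\<gamma> + 1)" by (simp add: t_def)
    then have t\<gamma>: "t * (\<gamma> + 1) \<le> \<beta>" using \<gamma> by (simp add: pos_le_divide_eq)
    define T where "T = (\<lambda>p. S0 p + t * (S p - S0 p))"
    have T_eq: "T p = (1 - t) * S0 p + t * S p" for p by (simp add: T_def algebra_simps)
    have "T \<in> psd_box W R"
      unfolding psd_box_def psd_kernel_def
    proof (intro CollectI conjI allI ballI)
      fix p
      let ?B = "if p \<in> W \<times> W then R else 0"
      have "\<bar>T p\<bar> \<le> (1 - t) * \<bar>S0 p\<bar> + t * \<bar>S p\<bar>"
        unfolding T_eq using t by (simp add: abs_mult order.trans[OF abs_triangle_ineq])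
      also have "\<dots> \<le> (1 - t) * ?B + t * ?B"
        using t by (intro add_mono mult_left_mono bounded S0 S) auto
      finally show "\<bar>T p\<bar> \<le> ?B" by (simp add: algebra_simps)
    next
      fix a b assume "a \<in> W" "b \<in> W"
      then show "T (a, b) = T (b, a)"
        using S0 S by (simp add: psd_box_def psd_kernel_def T_def)
    next
      fix x
      have "app W (\<lambda>u v. T (u, v)) x
          = (\<lambda>i. (1 - t) * app W (\<lambda>u v. S0 (u, v)) x i + t * app W (\<lambda>u v. S (u, v)) x i)"
        unfolding app_def T_eq by (simp add: ip_add_left ip_scale_left)
      then have "ip W x (app W (\<lambda>u v. T (u, v)) x)
          = (1 - t) * ip W x (app W (\<lambda>u v. S0 (u, v)) x) + t * ip W x (app W (\<lambda>u v. S (u, v)) x)"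
        by (simp only: ip_add_right ip_scale_right)
      also have "\<dots> \<ge> 0"
        using S0 S t by (simp add: psd_box_def psd_kernel_def)
      finally show "0 \<le> ip W x (app W (\<lambda>u v. T (u, v)) x)" .
    qed
    from min[OF this] have "F S0 \<le> F T" .
    also have "F T = (\<Sum>w\<in>V. (r w)\<^sup>2 + 2 * t * (r w * gram_coeff W S w - r w * gram_coeff W S0 w)
        + t\<^sup>2 * (gram_coeff W S w - gram_coeff W S0 w)\<^sup>2)"
      unfolding F_def T_def gram_coeff_line
      by (intro sum.cong refl) (simp add: r_def power2_eq_square algebra_simps)
    also have "\<dots> = F S0 + 2 * t * (- \<beta>) + t\<^sup>2 * \<gamma>"
      unfolding sum.distrib sum_distrib_left[symmetric] sum_subtractf pair
      by (simp add: F_def r_def \<beta>_def \<gamma>_def)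
    finally have "t * (2 * \<beta>) \<le> t * (t * \<gamma>)" by (simp add: power2_eq_square)
    then have "2 * \<beta> \<le> t * \<gamma>" using t by simp
    with t t\<gamma> \<beta> show False by (simp add: algebra_simps)
  qed
  define \<nu> \<rho> where "\<nu> = - pairing W r S0" and "\<rho> = (\<Sum>w\<in>V. (r w)\<^sup>2)"
  have \<nu>: "0 \<le> \<nu>" using first_order[OF zero] by (simp add: \<nu>_def pairing_def)
  obtain w where "w \<in> V" "g w \<noteq> gram_coeff W S0 w" using not_gram[OF psd0] by blast
  then have "w \<in> V" "r w \<noteq> 0" by (simp_all add: r_def)
  then have \<rho>: "0 < \<rho>"
    unfolding \<rho>_def using assms(2) by (intro sum_pos2[of V w]) auto
  have "(\<Sum>w\<in>V. r w * g w) = (\<Sum>w\<in>V. r w * gram_coeff W S0 w) - \<rho>"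
    unfolding \<rho>_def sum_subtractf[symmetric]
    by (intro sum.cong refl) (simp add: r_def power2_eq_square algebra_simps)
  then have val: "(\<Sum>w\<in>V. r w * g w) = - \<nu> - \<rho>" by (simp add: pair \<nu>_def)
  have lower: "- (\<nu> / R) * (\<Sum>u\<in>W. S (u, u)) \<le> pairing W r S"
    if S: "psd_kernel W (\<lambda>u v. S (u, v))" for S
  proof -
    define \<tau> where "\<tau> = (\<Sum>u\<in>W. S (u, u))"
    have entry: "\<bar>S (u, v)\<bar> \<le> \<tau>" if "u \<in> W" "v \<in> W" for u v
      using psd_kernel_entry_le_trace[OF assms(1) S that] by (simp add: \<tau>_def)
    show ?thesis
    proof (cases "\<tau> \<le> 0")
      case True
      then have "S (u, v) = 0" if "u \<in> W" "v \<in> W" for u v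
        using entry[OF that] by simp
      then show ?thesis by (simp add: pairing_def)
    next
      case False
      define T where "T = (\<lambda>p. R / \<tau> * (if p \<in> W \<times> W then S p else 0))"
      have "T \<in> psd_box W R"
        unfolding psd_box_def psd_kernel_def
      proof (intro CollectI conjI allI ballI)
        fix p
        show "\<bar>T p\<bar> \<le> (if p \<in> W \<times> W then R else 0)"
          using False R entry[of "fst p" "snd p"]
          by (auto simp: T_def abs_mult mult_le_cancel_left field_simps)
      next
        fix x
        have "ip W x (app W (\<lambda>u v. T (u, v)) x) = ip W x (\<lambda>i. R / \<tau> * app W (\<lambda>u v. S (u, v)) x i)"
          by (intro ip_cong refl)
            (simp add: app_def T_def ip_def sum_distrib_left mult_ac)
        then have "ip W x (app W (\<lambda>u v. T (u, v)) x) = R / \<tau> * ip W x (app W (\<lambda>u v. S (u, v)) x)"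
          by (simp only: ip_scale_right)
        then show "0 \<le> ip W x (app W (\<lambda>u v. T (u, v)) x)"
          using S False R by (simp add: psd_kernel_def)
      qed (use S in \<open>simp add: T_def psd_kernel_def\<close>)
      from first_order[OF this] have "- \<nu> \<le> pairing W r T" by (simp add: \<nu>_def)
      also have "pairing W r T = R / \<tau> * pairing W r S"
        unfolding T_def pairing_scale_right by (simp add: pairing_def)
      finally show ?thesis
        using False R by (simp add: \<tau>_def[symmetric] field_simps)
    qed
  qed
  have "r (rev w) = r w" for w
    by (simp add: r_def gram_coeff_rev[OF psd0] rev)
  from that[OF this \<nu> \<rho> val lower] show thesis .
qed

text \<open>
  Helton's theorem. If \<open>g\<close> were not a sum of squares, the separating functional, corrected by
  a multiple of the Fock functional to be positive definite, would be a vector state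
  at which \<open>g\<close> is negative.
\<close>

theorem sum_of_squares_if_nonneg:
  fixes g :: "('g::finite) free_poly"
  assumes sym: "symmetric_poly g" and deg: "Poly_Mapping.keys g \<subseteq> words (2 * d)"
    and nonneg: "\<And>X v. symmetric_kernels (words d :: 'g list set) X \<Longrightarrow> 0 \<le> qform (words d) X g v"
  shows "sum_of_squares g"
proof (rule ccontr)
  assume not_sos: "\<not> sum_of_squares g"
  let ?W = "words d :: 'g list set" and ?V = "words (2 * d) :: 'g list set"
  obtain C where C: "0 \<le> C" "\<And>S. psd_kernel ?W (\<lambda>u v. S (u, v)) \<Longrightarrow> (\<Sum>u\<in>?W. S (u, u)) \<le>
      pairing ?W (\<lambda>w. C * ip ?W vacuum (act ?W fock w vacuum)) S"
    using trace_le_fock_pairing[where 'g = 'g] by blast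
  define M where "M = (\<lambda>w. C * ip ?W vacuum (act ?W fock w vacuum))"
  define R where "R = max 1 (functional M g)"
  have R: "0 < R" "functional M g \<le> R" by (auto simp: R_def)
  have WV: "rev u @ v \<in> ?V" if "u \<in> ?W" "v \<in> ?W" for u v :: "'g list"
    using that by (simp add: words_def)
  have out: "gram_coeff ?W S w = 0" if "w \<notin> ?V" for S w
    unfolding gram_coeff_def pairing_def
    by (intro sum.neutral ballI) (use that WV in auto)
  have not_gram: "\<exists>w\<in>?V. Poly_Mapping.lookup g w \<noteq> gram_coeff ?W S w"
    if S: "psd_kernel ?W (\<lambda>u v. S (u, v))" for S
  proof (rule ccontr)
    assume "\<not> (\<exists>w\<in>?V. Poly_Mapping.lookup g w \<noteq> gram_coeff ?W S w)"
    moreover have "Poly_Mapping.lookup g w = 0" if "w \<notin> ?V" for w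
      using that deg by (auto simp: in_keys_iff)
    ultimately have "Poly_Mapping.lookup g w = gram_coeff ?W S w" for w
      using out by (cases "w \<in> ?V") auto
    with sum_of_squares_if_gram[OF finite_words S] not_sos show False by blast
  qed
  have g_rev: "Poly_Mapping.lookup g (rev w) = Poly_Mapping.lookup g w" for w
    using sym by (simp add: symmetric_poly_iff)
  obtain r \<nu> \<rho> where r: "\<And>w. r (rev w) = r w" and pos: "0 \<le> \<nu>" "0 < \<rho>"
    and val: "(\<Sum>w\<in>?V. r w * Poly_Mapping.lookup g w) = - \<nu> - \<rho>"
    and lower: "\<And>S. psd_kernel ?W (\<lambda>u v. S (u, v)) \<Longrightarrow>
      - (\<nu> / R) * (\<Sum>u\<in>?W. S (u, u)) \<le> pairing ?W r S"
    using separating_functional[OF finite_words[of d] finite_words[of "2 * d"] WV not_gram g_rev R(1)]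
    by blast
  \<comment> \<open>Small enough for the strict correction to keep the value at \<open>g\<close> negative.\<close>
  define \<epsilon> where "\<epsilon> = \<rho> / (2 * (\<bar>functional M g\<bar> + 1))"
  have \<epsilon>: "0 < \<epsilon>" "\<epsilon> * functional M g < \<rho>"
  proof -
    show "0 < \<epsilon>" using pos by (simp add: \<epsilon>_def)
    have "\<epsilon> * functional M g \<le> \<epsilon> * (\<bar>functional M g\<bar> + 1)"
      using \<open>0 < \<epsilon>\<close> by (intro mult_left_mono) auto
    also have "\<dots> = \<rho> / 2" by (simp add: \<epsilon>_def field_simps)
    finally show "\<epsilon> * functional M g < \<rho>" using pos by simp
  qed
  define L where "L = (\<lambda>w. r w + (\<nu> / R + \<epsilon>) * M w)"
  have M_rev: "M (rev w) = M w" for w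
    using ip_act_rev[OF symmetric_kernels_fock, of ?W vacuum "rev w" vacuum]
    by (simp add: M_def ip_commute[of ?W vacuum])
  have L_rev: "L (rev w) = L w" for w by (simp add: L_def r M_rev)
  have L_pos: "0 < ip ?W x (app ?W (\<lambda>u v. L (rev u @ v)) x)" if x: "\<exists>u\<in>?W. x u \<noteq> 0" for x
  proof -
    let ?S = "\<lambda>(u, v). x u * x v"
    have psd: "psd_kernel ?W (\<lambda>u v. ?S (u, v))" using psd_kernel_rank_one by simp
    define \<tau> where "\<tau> = (\<Sum>u\<in>?W. ?S (u, u))"
    have "0 < \<tau>"
      unfolding \<tau>_def using x by (auto intro!: sum_pos2 simp: zero_less_mult_iff)
    have "(\<nu> / R + \<epsilon>) * \<tau> \<le> (\<nu> / R + \<epsilon>) * pairing ?W M ?S"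
      using C(2)[OF psd] pos R \<epsilon> unfolding M_def[symmetric] \<tau>_def[symmetric]
      by (intro mult_left_mono) auto
    moreover have "- (\<nu> / R) * \<tau> \<le> pairing ?W r ?S"
      using lower[OF psd] by (simp add: \<tau>_def)
    moreover have "0 < \<epsilon> * \<tau>" using \<epsilon> \<open>0 < \<tau>\<close> by simp
    ultimately have "0 < pairing ?W L ?S"
      unfolding L_def pairing_add_left pairing_scale_left by (simp add: algebra_simps)
    then show ?thesis by (simp only: pairing_rank_one)
  qed
  obtain X v where X: "symmetric_kernels ?W X"
      "\<And>w. w \<in> ?V \<Longrightarrow> ip ?W v (act ?W X w v) = L w"
    using positive_functional_is_vector_state[of L d, OF L_rev L_pos] by blast
  have "qform ?W X g v = functional L g"
    unfolding qform_def functional_def using X(2) deg by (intro sum.cong refl) auto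
  also have "\<dots> = (\<Sum>w\<in>?V. r w * Poly_Mapping.lookup g w) + (\<nu> / R + \<epsilon>) * functional M g"
    unfolding functional_superset[OF finite_words deg] sum_distrib_left sum.distrib[symmetric] L_def
    by (intro sum.cong refl) (simp add: algebra_simps)
  also have "\<dots> < 0"
  proof -
    have "\<nu> / R * functional M g \<le> \<nu>"
      using mult_left_mono[OF R(2), of "\<nu> / R"] pos R by simp
    with \<epsilon> show ?thesis unfolding val by (simp add: algebra_simps)
  qed
  finally show False using nonneg[OF X(1)] by (metis not_le)
qed

section \<open>Polynomials of degree at most two\<close>

text \<open>
  The common meaning of the four conditions in terms of coefficients.
\<close>

definition convex_quadratic :: "('g::finite) free_poly \<Rightarrow> bool" where
  "convex_quadratic p \<longleftrightarrow> (\<forall>w. 2 < length w \<longrightarrow> Poly_Mapping.lookup p w = 0) \<and>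
    (\<forall>y. 0 \<le> (\<Sum>a\<in>UNIV. \<Sum>b\<in>UNIV. Poly_Mapping.lookup p [a, b] * y a * y b))"

lemma lookup_linear_part:
  fixes c :: "('g::finite) \<Rightarrow> real"
  shows "Poly_Mapping.lookup (\<Sum>a\<in>UNIV. Poly_Mapping.single [a] (c a)) w
    = (if length w = 1 then c (hd w) else 0)"
proof -
  have "Poly_Mapping.lookup (\<Sum>a\<in>UNIV. Poly_Mapping.single [a] (c a)) w
      = (\<Sum>a\<in>UNIV. if a = hd w then if length w = 1 then c (hd w) else 0 else 0)"
    unfolding lookup_sum by (intro sum.cong refl) (cases w; auto simp: lookup_single when_def)
  then show ?thesis by simp
qed

lemma lookup_quadratic_part:
  fixes c :: "('g::finite) \<Rightarrow> 'g \<Rightarrow> real"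
  shows "Poly_Mapping.lookup (\<Sum>a\<in>UNIV. \<Sum>b\<in>UNIV. Poly_Mapping.single [a, b] (c a b)) w
    = (if length w = 2 then c (hd w) (hd (tl w)) else 0)"
proof -
  have "Poly_Mapping.lookup (\<Sum>a\<in>UNIV. \<Sum>b\<in>UNIV. Poly_Mapping.single [a, b] (c a b)) w
      = (\<Sum>a\<in>UNIV. \<Sum>b\<in>UNIV. if b = hd (tl w) then
          if a = hd w then if length w = 2 then c (hd w) (hd (tl w)) else 0 else 0 else 0)"
    unfolding lookup_sum
    by (intro sum.cong refl) (cases w; cases "tl w"; auto simp: lookup_single when_def)
  then show ?thesis by simp
qed

lemma lookup_value_at_zero:
  "Poly_Mapping.lookup (value_at_zero p) w = (if w = [] then Poly_Mapping.lookup p [] else 0)"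
  by (simp add: value_at_zero_def lookup_single when_def)

lemma quadratic_poly_expand:
  fixes p :: "('g::finite) free_poly"
  assumes "\<And>w. 2 < length w \<Longrightarrow> Poly_Mapping.lookup p w = 0"
  shows "p = value_at_zero p
    + (\<Sum>a\<in>UNIV. Poly_Mapping.single [a] (Poly_Mapping.lookup p [a]))
    + (\<Sum>a\<in>UNIV. \<Sum>b\<in>UNIV. Poly_Mapping.single [a, b] (Poly_Mapping.lookup p [a, b]))"
proof (rule poly_mapping_eqI)
  fix w :: "'g list"
  consider "w = []" | a where "w = [a]" | a b u where "w = a # b # u"
    by (cases w rule: remdups_adj.cases)
  then show "Poly_Mapping.lookup p w = Poly_Mapping.lookup (value_at_zero p
    + (\<Sum>a\<in>UNIV. Poly_Mapping.single [a] (Poly_Mapping.lookup p [a]))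
    + (\<Sum>a\<in>UNIV. \<Sum>b\<in>UNIV. Poly_Mapping.single [a, b] (Poly_Mapping.lookup p [a, b]))) w"
  proof cases
    case (3 a b u)
    then show ?thesis
      using assms[of w]
      by (cases u) (simp_all add: lookup_add lookup_value_at_zero lookup_linear_part
        lookup_quadratic_part)
  qed (simp_all add: lookup_add lookup_value_at_zero lookup_linear_part lookup_quadratic_part)
qed

lemma square_of_linear:
  fixes c :: "('g::finite) \<Rightarrow> real"
  assumes "s = (\<Sum>a\<in>UNIV. Poly_Mapping.single [a] (c a))"
  shows "adjoint_poly s * s = (\<Sum>a\<in>UNIV. \<Sum>b\<in>UNIV. Poly_Mapping.single [a, b] (c a * c b))"
proof -
  have inj: "inj (\<lambda>a. [a])" by (simp add: inj_def)
  have "Poly_Mapping.keys s \<subseteq> range (\<lambda>a. [a])"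
    by (auto simp: in_keys_iff assms lookup_linear_part length_Suc_conv split: if_splits)
  from square_as_sum_of_words[OF _ this] show ?thesis
    by (simp add: sum.reindex[OF inj] lookup_linear_part assms)
qed

text \<open>
  The squares contribute the Gram matrix \<open>\<Sum> c\<^sub>j\<^sub>a c\<^sub>j\<^sub>b\<close> of their coefficients to the words of length
  two, and every positive semidefinite matrix is such a Gram matrix.
\<close>

lemma convex_quadratic_iff_linear_plus_squares:
  fixes p :: "('g::finite) free_poly"
  assumes "symmetric_poly p"
  shows "(\<exists>l (m::nat) s. linear_poly l \<and> (\<forall>j<m. linear_poly (s j)) \<and>
        p - value_at_zero p = l + (\<Sum>j<m. adjoint_poly (s j) * s j)) \<longleftrightarrow> convex_quadratic p"
proof
  assume "\<exists>l (m::nat) s. linear_poly l \<and> (\<forall>j<m. linear_poly (s j)) \<and>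
        p - value_at_zero p = l + (\<Sum>j<m. adjoint_poly (s j) * s j)"
  then obtain l and m :: nat and s where l: "linear_poly l" and s: "\<forall>j<m. linear_poly (s j)"
    and p: "p - value_at_zero p = l + (\<Sum>j<m. adjoint_poly (s j) * s j)" by blast
  obtain d where d: "l = (\<Sum>a\<in>UNIV. Poly_Mapping.single [a] (d a))"
    using l by (auto simp: linear_poly_def)
  have "\<forall>j. \<exists>c. j < m \<longrightarrow> s j = (\<Sum>a\<in>UNIV. Poly_Mapping.single [a] (c a))"
    using s by (auto simp: linear_poly_def)
  then obtain c where c: "\<And>j. j < m \<Longrightarrow> s j = (\<Sum>a\<in>UNIV. Poly_Mapping.single [a] (c j a))"
    by metis
  have "p = value_at_zero p + l
      + (\<Sum>j<m. \<Sum>a\<in>UNIV. \<Sum>b\<in>UNIV. Poly_Mapping.single [a, b] (c j a * c j b))"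
    using p square_of_linear[OF c] by (simp add: algebra_simps)
  from arg_cong[OF this, of "\<lambda>q. Poly_Mapping.lookup q w" for w]
  have "Poly_Mapping.lookup p w = Poly_Mapping.lookup (value_at_zero p) w + Poly_Mapping.lookup l w
      + (\<Sum>j<m. Poly_Mapping.lookup
          (\<Sum>a\<in>UNIV. \<Sum>b\<in>UNIV. Poly_Mapping.single [a, b] (c j a * c j b)) w)" for w
    by (simp only: lookup_add lookup_sum[where X = "{..<m}"])
  then have lookup: "Poly_Mapping.lookup p w = (if w = [] then Poly_Mapping.lookup p [] else 0)
      + (if length w = 1 then d (hd w) else 0)
      + (\<Sum>j<m. if length w = 2 then c j (hd w) * c j (hd (tl w)) else 0)" for w
    unfolding d lookup_value_at_zero lookup_linear_part lookup_quadratic_part .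
  show "convex_quadratic p"
    unfolding convex_quadratic_def
  proof (intro conjI allI impI)
    fix w :: "'g list" assume "2 < length w"
    then show "Poly_Mapping.lookup p w = 0" by (subst lookup) auto
  next
    fix y :: "'g \<Rightarrow> real"
    have "Poly_Mapping.lookup p [a, b] = (\<Sum>j<m. c j a * c j b)" for a b
      by (subst lookup) simp
    then have "(\<Sum>a\<in>UNIV. \<Sum>b\<in>UNIV. Poly_Mapping.lookup p [a, b] * y a * y b)
        = (\<Sum>a\<in>UNIV. \<Sum>b\<in>UNIV. \<Sum>j<m. (c j a * y a) * (c j b * y b))"
      by (simp add: sum_distrib_left sum_distrib_right mult_ac)
    also have "\<dots> = (\<Sum>a\<in>UNIV. \<Sum>j<m. \<Sum>b\<in>UNIV. (c j a * y a) * (c j b * y b))"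
      by (intro sum.cong refl sum.swap)
    also have "\<dots> = (\<Sum>j<m. \<Sum>a\<in>UNIV. \<Sum>b\<in>UNIV. (c j a * y a) * (c j b * y b))"
      by (rule sum.swap)
    also have "\<dots> = (\<Sum>j<m. (\<Sum>a\<in>UNIV. c j a * y a)\<^sup>2)"
      by (simp add: power2_eq_square sum_product)
    finally show "0 \<le> (\<Sum>a\<in>UNIV. \<Sum>b\<in>UNIV. Poly_Mapping.lookup p [a, b] * y a * y b)"
      by (simp add: sum_nonneg)
  qed
next
  assume cq: "convex_quadratic p"
  let ?Q = "\<lambda>a b. Poly_Mapping.lookup p [a, b]"
  have "psd_kernel UNIV ?Q"
    unfolding psd_kernel_def
  proof (intro conjI ballI allI)
    fix a b
    show "?Q a b = ?Q b a"
      using assms[unfolded symmetric_poly_iff, rule_format, of "[b, a]"] by simp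
  next
    fix x
    show "0 \<le> ip UNIV x (app UNIV ?Q x)"
      using cq by (simp add: convex_quadratic_def ip_def app_def sum_distrib_left mult_ac)
  qed
  from psd_decomposition[OF _ this] obtain c :: "'g \<Rightarrow> 'g \<Rightarrow> real"
    where "\<forall>a\<in>UNIV. \<forall>b\<in>UNIV. ?Q a b = (\<Sum>i\<in>UNIV. c i a * c i b)" by auto
  then have c: "?Q a b = (\<Sum>i\<in>UNIV. c i a * c i b)" for a b by blast
  obtain e where e: "bij_betw e {0..<card (UNIV :: 'g set)} (UNIV :: 'g set)"
    using ex_bij_betw_nat_finite[of "UNIV :: 'g set"] by auto
  define l where "l = (\<Sum>a\<in>UNIV. Poly_Mapping.single [a] (Poly_Mapping.lookup p [a]))"
  define s where "s = (\<lambda>i. \<Sum>a\<in>UNIV. Poly_Mapping.single [a] (c i a))"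
  have "(\<Sum>j<card (UNIV :: 'g set). adjoint_poly (s (e j)) * s (e j)) = (\<Sum>i\<in>UNIV. adjoint_poly (s i) * s i)"
    using sum.reindex_bij_betw[OF e, of "\<lambda>i. adjoint_poly (s i) * s i"]
    by (simp add: lessThan_atLeast0)
  also have "\<dots> = (\<Sum>i\<in>UNIV. \<Sum>a\<in>UNIV. \<Sum>b\<in>UNIV. Poly_Mapping.single [a, b] (c i a * c i b))"
    by (intro sum.cong refl square_of_linear) (simp add: s_def)
  also have "\<dots> = (\<Sum>a\<in>UNIV. \<Sum>b\<in>UNIV. Poly_Mapping.single [a, b] (?Q a b))"
    by (rule poly_mapping_eqI)
      (simp only: lookup_sum[where X = UNIV and pp = "\<lambda>i. \<Sum>a\<in>UNIV. \<Sum>b\<in>UNIV.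
        Poly_Mapping.single [a, b] (c i a * c i b)"] lookup_quadratic_part, simp add: c)
  finally have "p - value_at_zero p = l + (\<Sum>j<card (UNIV :: 'g set). adjoint_poly (s (e j)) * s (e j))"
    using quadratic_poly_expand[of p] cq
    by (simp add: convex_quadratic_def l_def algebra_simps)
  moreover have "linear_poly l" "linear_poly (s i)" for i
    by (auto simp: linear_poly_def l_def s_def)
  ultimately show "\<exists>l (m::nat) s. linear_poly l \<and> (\<forall>j<m. linear_poly (s j)) \<and>
        p - value_at_zero p = l + (\<Sum>j<m. adjoint_poly (s j) * s j)"
    by (intro exI[of _ l] exI[of _ "card (UNIV :: 'g set)"] exI[of _ "\<lambda>j. s (e j)"]) auto
qed

text \<open>
  Only the quadratic part contributes to the convexity defect, which is
  \<open>t (1 - t) \<Sum> p\<^sub>a\<^sub>b \<langle>(X\<^sub>a - Y\<^sub>a) v, (X\<^sub>b - Y\<^sub>b) v\<rangle>\<close>; each coordinate of this sum is a value of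
  the quadratic form \<open>(p\<^sub>a\<^sub>b)\<close>.
\<close>

lemma qform_convex:
  fixes p :: "('g::finite) free_poly"
  assumes p: "convex_quadratic p" and X: "symmetric_kernels I X" and Y: "symmetric_kernels I Y"
    and t: "0 \<le> t" "t \<le> 1"
  shows "qform I (\<lambda>a i k. t * X a i k + (1 - t) * Y a i k) p v
    \<le> t * qform I X p v + (1 - t) * qform I Y p v"
proof -
  define Z where "Z = (\<lambda>a i k. t * X a i k + (1 - t) * Y a i k)"
  have Z: "symmetric_kernels I Z" using X Y by (simp add: symmetric_kernels_def Z_def)
  have expand: "qform I V p v = Poly_Mapping.lookup p [] * ip I v v
      + (\<Sum>a\<in>UNIV. Poly_Mapping.lookup p [a] * ip I v (app I (V a) v))
      + (\<Sum>a\<in>UNIV. \<Sum>b\<in>UNIV. Poly_Mapping.lookup p [a, b] * ip I (app I (V a) v) (app I (V b) v))"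
    if V: "symmetric_kernels I V" for V :: "'g \<Rightarrow> _"
  proof -
    have "ip I v (app I (V a) u) = ip I (app I (V a) v) u" for a u
      using V by (simp add: ip_app_symmetric symmetric_kernels_def)
    then show ?thesis
      using p unfolding qform_def
      by (subst quadratic_poly_expand[of p])
        (simp_all add: convex_quadratic_def functional_add functional_sum value_at_zero_def)
  qed
  define x y z where "x = (\<lambda>a. app I (X a) v)" and "y = (\<lambda>a. app I (Y a) v)"
    and "z = (\<lambda>a. app I (Z a) v)"
  have z_eq: "z a i = t * x a i + (1 - t) * y a i" for a i
    by (simp add: z_def x_def y_def Z_def app_def ip_add_left ip_scale_left)
  then have lin: "ip I v (z a) = t * ip I v (x a) + (1 - t) * ip I v (y a)" for a
    using ip_add_right[of I v "\<lambda>i. t * x a i" "\<lambda>i. (1 - t) * y a i"]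
    by (simp add: ip_scale_right cong: ip_cong)
  have quad: "t * ip I (x a) (x b) + (1 - t) * ip I (y a) (y b) - ip I (z a) (z b)
      = t * (1 - t) * (\<Sum>i\<in>I. (x a i - y a i) * (x b i - y b i))" for a b
    unfolding ip_def sum_distrib_left sum.distrib[symmetric] sum_subtractf[symmetric]
    by (intro sum.cong refl) (simp add: z_eq algebra_simps)
  have "(\<Sum>a\<in>UNIV. \<Sum>b\<in>UNIV. Poly_Mapping.lookup p [a, b] * (\<Sum>i\<in>I. (x a i - y a i) * (x b i - y b i)))
      = (\<Sum>a\<in>UNIV. \<Sum>b\<in>UNIV. \<Sum>i\<in>I. Poly_Mapping.lookup p [a, b] * (x a i - y a i) * (x b i - y b i))"
    by (simp add: sum_distrib_left mult.assoc)
  also have "\<dots> = (\<Sum>a\<in>UNIV. \<Sum>i\<in>I. \<Sum>b\<in>UNIV. Poly_Mapping.lookup p [a, b] * (x a i - y a i) * (x b i - y b i))"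
    by (intro sum.cong refl sum.swap)
  also have "\<dots> = (\<Sum>i\<in>I. \<Sum>a\<in>UNIV. \<Sum>b\<in>UNIV. Poly_Mapping.lookup p [a, b] * (x a i - y a i) * (x b i - y b i))"
    by (rule sum.swap)
  also have "\<dots> \<ge> 0"
    by (rule sum_nonneg)
      (rule p[unfolded convex_quadratic_def, THEN conjunct2, rule_format])
  finally have "0 \<le> t * (1 - t) * (\<Sum>a\<in>UNIV. \<Sum>b\<in>UNIV.
      Poly_Mapping.lookup p [a, b] * (\<Sum>i\<in>I. (x a i - y a i) * (x b i - y b i)))"
    using t by (intro mult_nonneg_nonneg) auto
  also have "\<dots> = (\<Sum>a\<in>UNIV. \<Sum>b\<in>UNIV. Poly_Mapping.lookup p [a, b] *
      (t * ip I (x a) (x b) + (1 - t) * ip I (y a) (y b) - ip I (z a) (z b)))"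
    unfolding quad sum_distrib_left by (intro sum.cong refl) simp
  also have "\<dots> = t * qform I X p v + (1 - t) * qform I Y p v - qform I Z p v"
  proof -
    have "app I (X a) v = x a" "app I (Y a) v = y a" "app I (Z a) v = z a" for a
      by (simp_all add: x_def y_def z_def)
    then show ?thesis
      unfolding expand[OF X] expand[OF Y] expand[OF Z]
      by (simp add: lin sum.distrib sum_subtractf sum_distrib_left algebra_simps)
  qed
  finally show ?thesis unfolding Z_def by simp
qed

section \<open>Scalar quasi-convexity\<close>

text \<open>
  The level \<open>A\<close> of \<open>rank_one_level\<close> contains both end points, hence their midpoint, and tests it
  at \<open>v\<close>. The hypothesis \<open>conv\<close> covers both situations of interest: all symmetric levels, or
  the positive definite ones together with \<open>\<delta> > 0\<close>.
\<close>

lemma scalar_midpoint: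
  assumes p: "symmetric_poly p" and I: "finite I"
    and X: "symmetric_kernels I X" and Y: "symmetric_kernels I Y"
    and conv: "\<And>n A. 0 < n \<Longrightarrow> A \<in> sym_mats n \<Longrightarrow> (0 < \<delta> \<Longrightarrow> pos_def n A) \<Longrightarrow>
      convex_tuples (sublevel_set n p A)"
    and lX: "qform I X p v < \<delta>" and lY: "qform I Y p v < \<delta>"
  shows "qform I (\<lambda>a i k. (X a i k + Y a i k) / 2) p v < \<delta>"
proof (cases "\<exists>i\<in>I. v i \<noteq> 0")
  case False
  then have "qform I V p v = 0" for V
    by (simp add: qform_def ip_def functional_def)
  with lX show ?thesis by simp
next
  case True
  define n where "n = card I"
  obtain e where e: "bij_betw e {..<n} I"
    using ex_bij_betw_nat_finite[OF I] by (auto simp: n_def lessThan_atLeast0)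
  have n: "0 < n" using True I by (auto simp: n_def card_gt_0_iff)
  define Z where "Z = (\<lambda>a i k. (X a i k + Y a i k) / 2)"
  let ?X = "matrices_of e n X" and ?Y = "matrices_of e n Y" and ?Z = "matrices_of e n Z"
  let ?v = "vector_of e n v"
  have Z: "symmetric_kernels I Z" using X Y by (simp add: symmetric_kernels_def Z_def)
  have tuples: "?X \<in> sym_tuples n" "?Y \<in> sym_tuples n" "?Z \<in> sym_tuples n"
    using matrices_of_sym_tuples[OF e] X Y Z by auto
  have v: "?v \<in> carrier_vec n" by (simp add: vector_of_def)
  have v0: "?v \<noteq> 0\<^sub>v n"
  proof
    assume eq: "?v = 0\<^sub>v n"
    obtain i where "i \<in> I" "v i \<noteq> 0" using True by blast
    then obtain j where j: "j < n" "e j = i"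
      using e by (auto simp: bij_betw_def)
    then have "?v $ j = v i" by (simp add: vector_of_def)
    with eq j \<open>v i \<noteq> 0\<close> show False by simp
  qed
  let ?M = "{eval_poly n p ?X, eval_poly n p ?Y} \<union> (if 0 < \<delta> then {0\<^sub>m n n} else {})"
  note form = quadratic_form_matrices_of[OF e]
  obtain A where A: "A \<in> sym_mats n" "?v \<bullet> (A *\<^sub>v ?v) = \<delta>"
      and dominates: "\<And>M. M \<in> ?M \<Longrightarrow> pos_def n (A - M)"
  proof (rule rank_one_level[of ?M n ?v \<delta>])
    fix M assume M: "M \<in> ?M"
    show "M \<in> sym_mats n"
      using M eval_poly_symmetric[OF p] tuples
      by (auto simp: sym_mats_def split: if_splits)
    show "?v \<bullet> (M *\<^sub>v ?v) < \<delta>"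
    proof (cases "M = 0\<^sub>m n n \<and> 0 < \<delta>")
      case True
      have "?v \<bullet> (0\<^sub>m n n *\<^sub>v ?v) = 0"
        using v by (simp add: scalar_prod_def)
      with True show ?thesis by simp
    qed (use M lX lY in \<open>auto simp: form split: if_splits\<close>)
  qed (use v v0 in auto)
  have carr: "A \<in> carrier_mat n n" using A(1) by (simp add: sym_mats_def)
  have "pos_def n A" if "0 < \<delta>"
  proof -
    have "A - 0\<^sub>m n n = A" using carr by auto
    with dominates[of "0\<^sub>m n n"] that show ?thesis by simp
  qed
  with conv[OF n A(1)] have "convex_tuples (sublevel_set n p A)" by blast
  moreover have "?X \<in> sublevel_set n p A" "?Y \<in> sublevel_set n p A"
    using tuples dominates by (auto simp: sublevel_set_def)
  ultimately have "0 \<le> t \<and> t \<le> 1 \<longrightarrow> segment_point t ?X ?Y \<in> sublevel_set n p A" for t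
    unfolding convex_tuples_def by blast
  from this[of "1 / 2"] have "segment_point (1 / 2) ?X ?Y \<in> sublevel_set n p A" by simp
  moreover have "segment_point (1 / 2) ?X ?Y = ?Z"
    unfolding segment_point_def matrices_of_def Z_def by (intro ext eq_matI) (auto simp: field_simps)
  ultimately have "pos_def n (A - eval_poly n p ?Z)" by (simp add: sublevel_set_def)
  then have "0 < ?v \<bullet> ((A - eval_poly n p ?Z) *\<^sub>v ?v)"
    using v v0 by (simp add: pos_def_def)
  then show ?thesis
    using A(2) unfolding Z_def[symmetric] quadratic_form_minus[OF carr eval_poly_carrier v] form
    by simp
qed

section \<open>Bordered kernels\<close>

fun border :: "('g \<Rightarrow> 'i \<Rightarrow> 'i \<Rightarrow> real) \<Rightarrow> ('g \<Rightarrow> 'i \<Rightarrow> real) \<Rightarrow> real \<Rightarrow>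
    'g \<Rightarrow> 'i option \<Rightarrow> 'i option \<Rightarrow> real" where
  "border X k t a (Some i) (Some j) = X a i j"
| "border X k t a (Some i) None = t * k a i"
| "border X k t a None (Some i) = t * k a i"
| "border X k t a None None = 0"

text \<open>
  The vector \<open>w(border X k t) v\<close> for \<open>s = t\<^sup>2\<close>, split into its old coordinates and its new
  coordinate, the latter divided by \<open>t\<close>. In this form both parts are polynomials in \<open>s\<close>.
\<close>

primrec border_act :: "'i set \<Rightarrow> ('g \<Rightarrow> 'i \<Rightarrow> 'i \<Rightarrow> real) \<Rightarrow> ('g \<Rightarrow> 'i \<Rightarrow> real) \<Rightarrow>
    ('i \<Rightarrow> real) \<Rightarrow> real \<Rightarrow> 'g list \<Rightarrow> ('i \<Rightarrow> real) \<times> real" where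
  "border_act I X k v s [] = (v, 0)"
| "border_act I X k v s (a # w) =
    (\<lambda>i. app I (X a) (fst (border_act I X k v s w)) i + s * k a i * snd (border_act I X k v s w),
     ip I (k a) (fst (border_act I X k v s w)))"

text \<open>
  The derivative of the old coordinates with respect to \<open>s\<close> at \<open>s = 0\<close>.
\<close>

primrec border_deriv :: "'i set \<Rightarrow> ('g \<Rightarrow> 'i \<Rightarrow> 'i \<Rightarrow> real) \<Rightarrow> ('g \<Rightarrow> 'i \<Rightarrow> real) \<Rightarrow>
    ('i \<Rightarrow> real) \<Rightarrow> 'g list \<Rightarrow> 'i \<Rightarrow> real" where
  "border_deriv I X k v [] = (\<lambda>_. 0)"
| "border_deriv I X k v (a # w) =
    (\<lambda>i. app I (X a) (border_deriv I X k v w) i + k a i * snd (border_act I X k v 0 w))"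

abbreviation bordered :: "'i set \<Rightarrow> 'i option set" where
  "bordered I \<equiv> insert None (Some ` I)"

lemma ip_bordered:
  "finite I \<Longrightarrow> ip (bordered I) u v = u None * v None + ip I (\<lambda>i. u (Some i)) (\<lambda>i. v (Some i))"
  by (simp add: ip_def sum.reindex)

lemma act_border:
  assumes "finite I"
  shows "act (bordered I) (border X k t) w (case_option 0 v)
    = case_option (t * snd (border_act I X k v (t\<^sup>2) w)) (fst (border_act I X k v (t\<^sup>2) w))"
proof (induction w)
  case Nil
  show ?case by (auto split: option.split)
next
  case (Cons a w)
  show ?case
    unfolding act.simps Cons
    by (rule ext, rename_tac i, case_tac i)
      (simp_all add: app_def ip_bordered[OF assms] ip_scale_left power2_eq_square)
qed

lemma qform_border:
  assumes "finite I"
  shows "qform (bordered I) (border X k t) p (case_option 0 v)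
    = functional (\<lambda>w. ip I v (fst (border_act I X k v (t\<^sup>2) w))) p"
  by (simp add: qform_def act_border[OF assms] ip_bordered[OF assms])

lemma border_act_0: "fst (border_act I X k v 0 w) = act I X w v"
  by (induction w) simp_all

lemma border_act_deriv:
  "\<exists>d. ((\<lambda>s. snd (border_act I X k v s w)) has_real_derivative d) (at 0) \<and>
    (\<forall>i. ((\<lambda>s. fst (border_act I X k v s w) i) has_real_derivative border_deriv I X k v w i) (at 0))"
proof (induction w)
  case (Cons a w)
  then obtain d where d: "((\<lambda>s. snd (border_act I X k v s w)) has_real_derivative d) (at 0)"
    and u: "\<And>i. ((\<lambda>s. fst (border_act I X k v s w) i) has_real_derivative border_deriv I X k v w i) (at 0)"
    by blast
  have ip: "((\<lambda>s. ip I c (fst (border_act I X k v s w))) has_real_derivative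
      ip I c (border_deriv I X k v w)) (at 0)" for c
    unfolding ip_def by (intro DERIV_sum DERIV_cmult u)
  have "((\<lambda>s. fst (border_act I X k v s (a # w)) i) has_real_derivative
      border_deriv I X k v (a # w) i) (at 0)" for i
    by (auto intro!: derivative_eq_intros ip d simp: app_def)
  with ip show ?case by auto
qed (auto intro!: exI[of _ 0])

text \<open>
  The values at \<open>t\<close> and \<open>- t\<close> agree, so they cannot both be below the value at their midpoint
  \<open>t = 0\<close>. That value has to be positive because only positive levels are known to be
  convex.
\<close>

lemma border_deriv_nonneg:
  assumes p: "symmetric_poly p" and I: "finite I" and X: "symmetric_kernels I X"
    and conv: "\<And>n A. 0 < n \<Longrightarrow> pos_def n A \<Longrightarrow> convex_tuples (sublevel_set n p A)"
    and pos: "0 < qform I X p v"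
  shows "0 \<le> functional (\<lambda>w. ip I v (border_deriv I X k v w)) p"
proof (rule ccontr)
  define \<psi> where "\<psi> = (\<lambda>s. functional (\<lambda>w. ip I v (fst (border_act I X k v s w))) p)"
  have \<psi>0: "\<psi> 0 = qform I X p v" by (simp add: \<psi>_def border_act_0 qform_def)
  have "((\<lambda>s. fst (border_act I X k v s w) i) has_real_derivative border_deriv I X k v w i) (at 0)"
    for w i using border_act_deriv[of I X k v w] by blast
  then have "(\<psi> has_real_derivative functional (\<lambda>w. ip I v (border_deriv I X k v w)) p) (at 0)"
    unfolding \<psi>_def functional_def ip_def by (intro DERIV_sum DERIV_cmult) auto
  moreover assume "\<not> 0 \<le> functional (\<lambda>w. ip I v (border_deriv I X k v w)) p"
  then have "functional (\<lambda>w. ip I v (border_deriv I X k v w)) p < 0" by simp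
  ultimately have "\<exists>d>0. \<forall>h>0. 0 + h \<in> UNIV \<longrightarrow> h < d \<longrightarrow> \<psi> (0 + h) < \<psi> 0"
    by (rule has_real_derivative_neg_dec_right)
  then obtain d where d: "0 < d" "\<And>h. 0 < h \<Longrightarrow> h < d \<Longrightarrow> \<psi> h < \<psi> 0" by auto
  define t where "t = sqrt (d / 2)"
  have "\<psi> (t\<^sup>2) < \<psi> 0" using d by (simp add: t_def)
  then have level: "qform (bordered I) (border X k t) p (case_option 0 v) < \<psi> 0"
    "qform (bordered I) (border X k (- t)) p (case_option 0 v) < \<psi> 0"
    by (simp_all add: qform_border[OF I] \<psi>_def)
  have sym: "symmetric_kernels (bordered I) (border X k r)" for r
    using X by (auto simp: symmetric_kernels_def)
  have "qform (bordered I) (\<lambda>a i j. (border X k t a i j + border X k (- t) a i j) / 2) p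
      (case_option 0 v) < \<psi> 0"
  proof (rule scalar_midpoint[OF p _ sym sym _ level])
    show "convex_tuples (sublevel_set n p A)" if "0 < n" "0 < \<psi> 0 \<Longrightarrow> pos_def n A" for n A
      using conv that pos \<psi>0 by simp
  qed (use I in auto)
  also have "(\<lambda>a i j. (border X k t a i j + border X k (- t) a i j) / 2) = border X k 0"
  proof (intro ext)
    fix a i j
    show "(border X k t a i j + border X k (- t) a i j) / 2 = border X k 0 a i j"
      by (cases i; cases j) auto
  qed
  finally show False by (simp add: qform_border[OF I] \<psi>_def)
qed

text \<open>
  The first-order term in \<open>s\<close> collects the passages through the new coordinate: a word
  \<open>m\<^sup>* a b n\<close> runs through \<open>n\<close>, enters by \<open>b\<close>, leaves by \<open>a\<close> and runs through \<open>m\<^sup>*\<close>, which can be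
  moved to the other side of the inner product. In the induction the initial part of the word has
  already been moved there as \<open>m0\<close>, and only the passages after it are counted.
\<close>

lemma border_deriv_expand:
  assumes I: "finite I" and X: "symmetric_kernels I X" and Z: "finite Z"
    and y: "\<And>a m. length m \<le> d \<Longrightarrow> ip I (k a) (act I X m v) = y a m"
    and y0: "\<And>a m. (a, m) \<notin> Z \<Longrightarrow> y a m = 0"
  shows "length m0 + length w \<le> Suc d \<Longrightarrow> ip I (act I X m0 v) (border_deriv I X k v w)
    = (\<Sum>(a, m)\<in>Z. \<Sum>(b, n)\<in>Z. if rev m0 @ w = rev m @ [a, b] @ n \<and> length m0 \<le> length m
        then y a m * y b n else 0)"
proof (induction w arbitrary: m0)
  case Nil
  have "(if rev m0 @ [] = rev m @ [a, b] @ n \<and> length m0 \<le> length m then y a m * y b n else 0) = 0"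
    for a b m n
    by (auto dest: arg_cong[of _ _ length])
  then show ?case by (simp add: ip_def case_prod_beta)
next
  case (Cons c w)
  let ?now = "\<lambda>a m b n. if m = m0 \<and> a = c \<and> w = b # n then y a m * y b n else 0"
  have m0: "length m0 \<le> d" using Cons.prems by simp
  have tail: "snd (border_act I X k v 0 w) = (case w of [] \<Rightarrow> 0 | b # n \<Rightarrow> y b n)"
    using Cons.prems by (cases w) (simp_all add: border_act_0 y)
  have split: "(if rev m0 @ c # w = rev m @ [a, b] @ n \<and> length m0 \<le> length m then y a m * y b n else 0)
      = (if rev (c # m0) @ w = rev m @ [a, b] @ n \<and> length (c # m0) \<le> length m
          then y a m * y b n else 0) + ?now a m b n" for a m b n
    by (cases "length m = length m0") auto
  have "(\<Sum>(b, n)\<in>Z. ?now a m b n)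
      = (if (a, m) = (c, m0) then y c m0 * (case w of [] \<Rightarrow> 0 | b # n \<Rightarrow> y b n) else 0)" for a m
  proof (cases w)
    case (Cons b' n')
    have "(\<Sum>(b, n)\<in>Z. ?now a m b n) = (\<Sum>x\<in>Z. if x = (b', n') then
        if (a, m) = (c, m0) then y c m0 * y b' n' else 0 else 0)"
      by (intro sum.cong refl) (auto simp: Cons split: if_splits)
    then show ?thesis using Z y0 Cons by auto
  qed (simp add: case_prod_beta)
  then have "(\<Sum>(a, m)\<in>Z. \<Sum>(b, n)\<in>Z. ?now a m b n)
      = (\<Sum>x\<in>Z. if x = (c, m0) then y c m0 * (case w of [] \<Rightarrow> 0 | b # n \<Rightarrow> y b n) else 0)"
    by (intro sum.cong refl) (simp add: split_beta prod_eq_iff)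
  also have "\<dots> = y c m0 * snd (border_act I X k v 0 w)"
    using Z y0 by (simp add: tail)
  finally have now: "(\<Sum>(a, m)\<in>Z. \<Sum>(b, n)\<in>Z. ?now a m b n) = y c m0 * snd (border_act I X k v 0 w)" .
  have "ip I (act I X m0 v) (border_deriv I X k v (c # w))
      = ip I (act I X m0 v) (app I (X c) (border_deriv I X k v w))
        + ip I (act I X m0 v) (k c) * snd (border_act I X k v 0 w)"
    by (simp add: ip_add_right) (simp add: ip_def sum_distrib_right mult.assoc)
  also have "ip I (act I X m0 v) (app I (X c) (border_deriv I X k v w))
      = ip I (act I X (c # m0) v) (border_deriv I X k v w)"
    using X by (simp add: ip_app_symmetric symmetric_kernels_def)
  also have "ip I (act I X m0 v) (k c) = y c m0"
    using y[OF m0] by (simp add: ip_commute)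
  also have "ip I (act I X (c # m0) v) (border_deriv I X k v w)
      + y c m0 * snd (border_act I X k v 0 w)
      = (\<Sum>(a, m)\<in>Z. \<Sum>(b, n)\<in>Z. if rev (c # m0) @ w = rev m @ [a, b] @ n
            \<and> length (c # m0) \<le> length m then y a m * y b n else 0)
        + (\<Sum>(a, m)\<in>Z. \<Sum>(b, n)\<in>Z. ?now a m b n)"
    unfolding now using Cons.IH[of "c # m0"] Cons.prems by simp
  also have "\<dots> = (\<Sum>(a, m)\<in>Z. \<Sum>(b, n)\<in>Z. if rev m0 @ c # w = rev m @ [a, b] @ n
            \<and> length m0 \<le> length m then y a m * y b n else 0)"
    by (simp only: split case_prod_unfold sum.distrib)
  finally show ?case .
qed

section \<open>Quasi-convexity bounds the degree\<close>

fun dsum :: "('g \<Rightarrow> 'i \<Rightarrow> 'i \<Rightarrow> real) \<Rightarrow> ('g \<Rightarrow> 'j \<Rightarrow> 'j \<Rightarrow> real) \<Rightarrow> 'g \<Rightarrow> 'i + 'j \<Rightarrow> 'i + 'j \<Rightarrow> real" where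
  "dsum X Y a (Inl i) (Inl k) = X a i k"
| "dsum X Y a (Inr i) (Inr k) = Y a i k"
| "dsum X Y a (Inl i) (Inr k) = 0"
| "dsum X Y a (Inr i) (Inl k) = 0"

lemma ip_Plus:
  assumes "finite I" "finite J"
  shows "ip (I <+> J) u v = ip I (\<lambda>i. u (Inl i)) (\<lambda>i. v (Inl i)) + ip J (\<lambda>j. u (Inr j)) (\<lambda>j. v (Inr j))"
  using sum.Plus[OF assms, of "\<lambda>x. u x * v x"] by (simp add: ip_def o_def)

lemma act_dsum:
  assumes "finite I" "finite J"
  shows "act (I <+> J) (dsum X Y) w (case_sum u v) = case_sum (act I X w u) (act J Y w v)"
proof (induction w)
  case (Cons a w)
  show ?case
    unfolding act.simps Cons
    by (rule ext, rename_tac i, case_tac i)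
      (simp_all add: app_def ip_Plus[OF assms], simp_all add: ip_def)
qed (simp add: fun_eq_iff split: sum.split)

lemma qform_dsum:
  assumes "finite I" "finite J"
  shows "qform (I <+> J) (dsum X Y) p (case_sum u v) = qform I X p u + qform J Y p v"
  by (simp add: qform_def act_dsum[OF assms] ip_Plus[OF assms] functional_def
      sum.distrib distrib_left)

lemma symmetric_kernels_dsum:
  "symmetric_kernels I X \<Longrightarrow> symmetric_kernels J Y \<Longrightarrow> symmetric_kernels (I <+> J) (dsum X Y)"
  by (auto simp: symmetric_kernels_def)

text \<open>
  The second-order condition for the bordered direct sum of the Fock tuple and \<open>Y\<close>. The Fock summand
  makes the numbers \<open>\<langle>k\<^sub>a, m(X) v\<rangle>\<close> arbitrary, and the summand \<open>Y\<close> makes the value of \<open>p\<close>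
  positive.
\<close>

lemma middle_matrix_nonneg:
  fixes p :: "('g::finite) free_poly"
  assumes p: "symmetric_poly p" and deg: "Poly_Mapping.keys p \<subseteq> words d"
    and conv: "\<And>n A. 0 < n \<Longrightarrow> pos_def n A \<Longrightarrow> convex_tuples (sublevel_set n p A)"
    and J: "finite (J :: 'j set)" and Y: "symmetric_kernels J Y" and pos: "0 < qform J Y p u"
    and Z: "finite Z"
  shows "0 \<le> (\<Sum>(a, m)\<in>Z. \<Sum>(b, n)\<in>Z. Poly_Mapping.lookup p (rev m @ [a, b] @ n) * y a m * y b n)"
proof -
  let ?W = "words d :: 'g list set"
  let ?I = "?W <+> J"
  \<comment> \<open>The prescribed values have to vanish outside the finite set \<open>Z\<close>.\<close>
  define y' where "y' = (\<lambda>a m. if (a, m) \<in> Z then y a m else 0)"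
  define X where "X = dsum (fock :: 'g \<Rightarrow> _) Y"
  have I: "finite ?I" using J by simp
  have X: "symmetric_kernels ?I X"
    unfolding X_def by (intro symmetric_kernels_dsum symmetric_kernels_fock Y)
  define q where "q = qform ?W fock p vacuum"
  \<comment> \<open>A weight on \<open>u\<close> for which the second summand outweighs \<open>q\<close>, using \<open>c \<le> c\<^sup>2\<close>.\<close>
  define c where "c = 1 + \<bar>q\<bar> / qform J Y p u"
  define v :: "'g list + 'j \<Rightarrow> real" where "v = case_sum vacuum (\<lambda>j. c * u j)"
  have "1 \<le> c" using pos by (simp add: c_def)
  then have "c * qform J Y p u \<le> c\<^sup>2 * qform J Y p u"
    using pos by (intro mult_right_mono) (auto simp: power2_eq_square)
  moreover have "c * qform J Y p u = qform J Y p u + \<bar>q\<bar>"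
    using pos by (simp add: c_def field_simps)
  ultimately have "0 < qform ?I X p v"
    unfolding v_def X_def qform_dsum[OF finite_words J] qform_scale q_def[symmetric]
    using pos by linarith
  note nonneg = border_deriv_nonneg[OF p I X conv this]
  have "\<forall>a. \<exists>k. \<forall>m\<in>?W. ip ?W k (act ?W fock m vacuum) = y' a m"
    by (intro allI fock_dual_functional)
  then obtain \<kappa> where \<kappa>: "\<And>a m. m \<in> ?W \<Longrightarrow> ip ?W (\<kappa> a) (act ?W fock m vacuum) = y' a m"
    by metis
  define k where "k = (\<lambda>a. case_sum (\<kappa> a) (\<lambda>_ :: 'j. 0 :: real))"
  have k: "ip ?I (k a) (act ?I X m v) = y' a m" if "length m \<le> d" for a m
  proof -
    have "m \<in> ?W" using that by (simp add: words_def)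
    then show ?thesis
      unfolding k_def X_def v_def act_dsum[OF finite_words J] ip_Plus[OF finite_words J]
      by (simp add: \<kappa>) (simp add: ip_def)
  qed
  have "ip ?I v (border_deriv ?I X k v w)
    = (\<Sum>(a, m)\<in>Z. \<Sum>(b, n)\<in>Z. if w = rev m @ [a, b] @ n then y' a m * y' b n else 0)"
    if "w \<in> ?W" for w
  proof -
    have "length ([] :: 'g list) + length w \<le> Suc d" using that by (simp add: words_def)
    from border_deriv_expand[OF I X Z k _ this] show ?thesis by (simp add: y'_def)
  qed
  then have "functional (\<lambda>w. ip ?I v (border_deriv ?I X k v w)) p
    = (\<Sum>w\<in>Poly_Mapping.keys p. \<Sum>(a, m)\<in>Z. \<Sum>(b, n)\<in>Z.
        if w = rev m @ [a, b] @ n then Poly_Mapping.lookup p w * (y' a m * y' b n) else 0)"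
    unfolding functional_def using deg
    by (intro sum.cong refl) (auto simp: sum_distrib_left case_prod_unfold if_distrib cong: if_cong)
  also have "\<dots> = (\<Sum>(a, m)\<in>Z. \<Sum>(b, n)\<in>Z. \<Sum>w\<in>Poly_Mapping.keys p.
        if w = rev m @ [a, b] @ n then Poly_Mapping.lookup p w * (y' a m * y' b n) else 0)"
    unfolding case_prod_unfold
    by (subst sum.swap, intro sum.cong refl, subst sum.swap, rule refl)
  also have "\<dots> = (\<Sum>(a, m)\<in>Z. \<Sum>(b, n)\<in>Z. Poly_Mapping.lookup p (rev m @ [a, b] @ n) * y a m * y b n)"
    unfolding case_prod_unfold
    by (intro sum.cong refl) (auto simp: in_keys_iff y'_def)
  finally show ?thesis using nonneg[of k] by simp
qed

text \<open>
  Let \<open>z = a b n\<close> be a word of maximal length \<open>d > 2\<close>. On the index pairs \<open>(a, \<emptyset>)\<close> and \<open>(b, n)\<close> the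
  nonnegative form has the off-diagonal entry \<open>p\<^sub>z\<close> and the diagonal entry \<open>p\<close> at
  \<open>n\<^sup>* b b n\<close>, which is zero because this word has length \<open>2 d - 2 > d\<close>.
\<close>

lemma convex_quadratic_if_quasi_convex:
  fixes p :: "('g::finite) free_poly"
  assumes p: "symmetric_poly p"
    and conv: "\<And>n A. 0 < n \<Longrightarrow> pos_def n A \<Longrightarrow> convex_tuples (sublevel_set n p A)"
    and J: "finite J" and Y: "symmetric_kernels J Y" and pos: "0 < qform J Y p u"
  shows "convex_quadratic p"
proof -
  let ?p = "Poly_Mapping.lookup p"
  define d where "d = Max (insert 0 (length ` Poly_Mapping.keys p))"
  have deg: "Poly_Mapping.keys p \<subseteq> words d"
    by (auto simp: words_def d_def)
  note nonneg = middle_matrix_nonneg[OF p deg conv J Y pos]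
  have high: "?p w = 0" if "2 < length w" for w
  proof (rule ccontr)
    assume "?p w \<noteq> 0"
    then have "w \<in> Poly_Mapping.keys p" by (simp add: in_keys_iff)
    then have "length w \<le> d" by (simp add: d_def)
    with that have d: "2 < d" by simp
    have "d \<in> insert 0 (length ` Poly_Mapping.keys p)"
      unfolding d_def by (rule Max_in) auto
    with d obtain z where z: "?p z \<noteq> 0" "length z = d"
      by (auto simp: in_keys_iff)
    obtain a b n where abn: "z = a # b # n" "n \<noteq> []"
      using d z by (cases z rule: remdups_adj.cases) auto
    have rev_z: "?p (rev n @ [b, a]) = ?p z"
      using p[unfolded symmetric_poly_iff, rule_format, of z] by (simp add: abn)
    have "?p (rev n @ b # b # n) = 0"
    proof (rule ccontr)
      assume "?p (rev n @ b # b # n) \<noteq> 0"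
      then have "rev n @ b # b # n \<in> words d" using deg by (auto simp: in_keys_iff)
      then show False using z d by (simp add: words_def abn)
    qed
    then have quad: "0 \<le> \<alpha>\<^sup>2 * ?p [a, a] + 2 * \<alpha> * ?p z" for \<alpha>
      using nonneg[of "{(a, []), (b, n)}" "\<lambda>_ m. if m = [] then \<alpha> else 1"] abn(2) rev_z
      by (simp add: power2_eq_square abn(1) algebra_simps)
    \<comment> \<open>The choice \<open>\<alpha> = - p\<^sub>z / \<beta>\<close> makes the linear term of \<open>quad\<close> dominate.\<close>
    define \<beta> where "\<beta> = 1 + \<bar>?p [a, a]\<bar>"
    have \<beta>: "0 < \<beta>" "?p [a, a] < 2 * \<beta>" by (auto simp: \<beta>_def)
    have "0 \<le> \<beta>\<^sup>2 * ((- ?p z / \<beta>)\<^sup>2 * ?p [a, a] + 2 * (- ?p z / \<beta>) * ?p z)"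
      by (intro mult_nonneg_nonneg quad) simp
    also have "\<dots> = (?p z)\<^sup>2 * (?p [a, a] - 2 * \<beta>)"
      using \<beta> by (simp add: field_simps power2_eq_square)
    also have "\<dots> < 0" using z \<beta> by (simp add: mult_pos_neg)
    finally show False by simp
  qed
  show ?thesis
    unfolding convex_quadratic_def
  proof (intro conjI allI impI)
    fix y :: "'g \<Rightarrow> real"
    have inj: "inj (\<lambda>a. (a, []))" by (simp add: inj_def)
    show "0 \<le> (\<Sum>a\<in>UNIV. \<Sum>b\<in>UNIV. ?p [a, b] * y a * y b)"
      using nonneg[of "range (\<lambda>a. (a, []))" "\<lambda>a _. y a"]
      by (simp add: sum.reindex[OF inj])
  qed (rule high)
qed

section \<open>Matrix convexity of convex quadratic polynomials\<close>

lemma transpose_combination: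
  fixes A B :: "real mat"
  assumes "A \<in> carrier_mat n n" "B \<in> carrier_mat n n"
  shows "transpose_mat (s \<cdot>\<^sub>m A + t \<cdot>\<^sub>m B) = s \<cdot>\<^sub>m transpose_mat A + t \<cdot>\<^sub>m transpose_mat B"
  using assms by (intro eq_matI) auto

lemma segment_point_sym_tuples:
  assumes "X \<in> sym_tuples n" "Y \<in> sym_tuples n"
  shows "segment_point t X Y \<in> sym_tuples n"
proof -
  have "X a \<in> carrier_mat n n" "transpose_mat (X a) = X a"
    "Y a \<in> carrier_mat n n" "transpose_mat (Y a) = Y a" for a
    using assms by (auto simp: sym_tuples_def sym_mats_def)
  then show ?thesis
    by (simp add: sym_tuples_def sym_mats_def segment_point_def transpose_combination[of _ n])
qed

lemma quadratic_form_combination: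
  fixes v :: "real vec"
  assumes "A \<in> carrier_mat n n" "B \<in> carrier_mat n n" "v \<in> carrier_vec n"
  shows "v \<bullet> ((s \<cdot>\<^sub>m A + t \<cdot>\<^sub>m B) *\<^sub>v v) = s * (v \<bullet> (A *\<^sub>v v)) + t * (v \<bullet> (B *\<^sub>v v))"
proof -
  have "(s \<cdot>\<^sub>m A + t \<cdot>\<^sub>m B) *\<^sub>v v = s \<cdot>\<^sub>v (A *\<^sub>v v) + t \<cdot>\<^sub>v (B *\<^sub>v v)"
    using assms by (intro eq_vecI) (auto simp: scalar_prod_def sum.distrib sum_distrib_left algebra_simps)
  then show ?thesis
    using assms by (simp add: scalar_prod_add_distrib[of _ n])
qed

lemma matrix_convex_if_convex_quadratic:
  fixes p :: "('g::finite) free_poly"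
  assumes p: "symmetric_poly p" and cq: "convex_quadratic p"
  shows "matrix_convex p"
  unfolding matrix_convex_def loewner_le_def pos_semidef_def
proof (intro conjI allI impI ballI)
  fix n and X Y :: "'g \<Rightarrow> real mat" and t :: real
  assume X: "X \<in> sym_tuples n" and Y: "Y \<in> sym_tuples n" and t: "0 \<le> t \<and> t \<le> 1"
  let ?Z = "segment_point t X Y"
  let ?C = "t \<cdot>\<^sub>m eval_poly n p X + (1 - t) \<cdot>\<^sub>m eval_poly n p Y"
  have Z: "?Z \<in> sym_tuples n" by (rule segment_point_sym_tuples[OF X Y])
  have trans: "transpose_mat (eval_poly n p V) = eval_poly n p V" if "V \<in> sym_tuples n" for V
    using eval_poly_symmetric[OF p that] by (simp add: sym_mats_def)
  have C: "?C \<in> carrier_mat n n" by simp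
  have "transpose_mat ?C = ?C"
    using trans[OF X] trans[OF Y] by (simp add: transpose_combination[of _ n])
  then show "?C - eval_poly n p ?Z \<in> sym_mats n"
    using trans[OF Z] transpose_minus[OF C eval_poly_carrier, of p ?Z]
      minus_carrier_mat[OF eval_poly_carrier, of ?C n p ?Z]
    by (simp add: sym_mats_def)
  fix v :: "real vec" assume v: "v \<in> carrier_vec n"
  have carr: "X a \<in> carrier_mat n n" "Y a \<in> carrier_mat n n" for a
    using X Y by (auto simp: sym_tuples_def sym_mats_def)
  have "qform {..<n} (\<lambda>a i k. ?Z a $$ (i, k)) p (($) v)
      = qform {..<n} (\<lambda>a i k. t * X a $$ (i, k) + (1 - t) * Y a $$ (i, k)) p (($) v)"
  proof -
    have "act {..<n} (\<lambda>a i k. ?Z a $$ (i, k)) w (($) v) i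
        = act {..<n} (\<lambda>a i k. t * X a $$ (i, k) + (1 - t) * Y a $$ (i, k)) w (($) v) i"
      if "i < n" for w i
      using that
    proof (induction w arbitrary: i)
      case (Cons a w)
      then show ?case
        using carrier_matD[OF carr(1)[of a]] carrier_matD[OF carr(2)[of a]]
        by (auto simp: app_def segment_point_def intro!: ip_cong)
    qed simp
    then show ?thesis
      by (auto simp: qform_def functional_def intro!: sum.cong ip_cong)
  qed
  also have "\<dots> \<le> t * qform {..<n} (\<lambda>a i k. X a $$ (i, k)) p (($) v)
      + (1 - t) * qform {..<n} (\<lambda>a i k. Y a $$ (i, k)) p (($) v)"
    by (rule qform_convex[OF cq]) (use t quadratic_form_as_qform(2)[OF X v]
        quadratic_form_as_qform(2)[OF Y v] in auto)
  finally show "0 \<le> v \<bullet> ((?C - eval_poly n p ?Z) *\<^sub>v v)"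
    unfolding quadratic_form_minus[OF C eval_poly_carrier v]
      quadratic_form_combination[OF eval_poly_carrier eval_poly_carrier v]
      quadratic_form_as_qform(1)[OF X v] quadratic_form_as_qform(1)[OF Y v]
      quadratic_form_as_qform(1)[OF Z v]
    by simp
qed (rule p)

lemma convex_sublevel_if_matrix_convex:
  assumes mc: "matrix_convex p" and n: "0 < n" and A: "A \<in> sym_mats n"
  shows "convex_tuples (sublevel_set n p A)"
  unfolding convex_tuples_def
proof (intro ballI allI impI)
  fix X Y and t :: real
  assume XY: "X \<in> sublevel_set n p A" "Y \<in> sublevel_set n p A" and t: "0 \<le> t \<and> t \<le> 1"
  let ?Z = "segment_point t X Y"
  have X: "X \<in> sym_tuples n" "pos_def n (A - eval_poly n p X)"
    and Y: "Y \<in> sym_tuples n" "pos_def n (A - eval_poly n p Y)"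
    using XY by (auto simp: sublevel_set_def)
  have p: "symmetric_poly p" using mc by (simp add: matrix_convex_def)
  have Z: "?Z \<in> sym_tuples n" by (rule segment_point_sym_tuples[OF X(1) Y(1)])
  have carr: "A \<in> carrier_mat n n" "transpose_mat A = A" using A by (auto simp: sym_mats_def)
  have C: "t \<cdot>\<^sub>m eval_poly n p X + (1 - t) \<cdot>\<^sub>m eval_poly n p Y \<in> carrier_mat n n" by simp
  have "pos_def n (A - eval_poly n p ?Z)"
    unfolding pos_def_def
  proof (intro conjI ballI impI)
    show "A - eval_poly n p ?Z \<in> sym_mats n"
      using eval_poly_symmetric[OF p Z] transpose_minus[OF carr(1) eval_poly_carrier, of p ?Z]
        carr(2) minus_carrier_mat[OF eval_poly_carrier, of A n p ?Z]
      by (simp add: sym_mats_def)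
    fix v :: "real vec" assume v: "v \<in> carrier_vec n" "v \<noteq> 0\<^sub>v n"
    define x y where "x = v \<bullet> (A *\<^sub>v v) - v \<bullet> (eval_poly n p X *\<^sub>v v)"
      and "y = v \<bullet> (A *\<^sub>v v) - v \<bullet> (eval_poly n p Y *\<^sub>v v)"
    have "0 < x" "0 < y"
      using X(2) Y(2) v
      unfolding pos_def_def x_def y_def quadratic_form_minus[OF carr(1) eval_poly_carrier v(1), symmetric]
      by blast+
    then have "0 < t * x + (1 - t) * y"
      using t by (cases "t = 0") (auto intro: add_pos_nonneg)
    moreover have "0 \<le> t * (v \<bullet> (eval_poly n p X *\<^sub>v v)) + (1 - t) * (v \<bullet> (eval_poly n p Y *\<^sub>v v))
        - v \<bullet> (eval_poly n p ?Z *\<^sub>v v)"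
      using mc n X(1) Y(1) t v(1)
      unfolding matrix_convex_def loewner_le_def pos_semidef_def
        quadratic_form_minus[OF C eval_poly_carrier v(1), symmetric]
        quadratic_form_combination[OF eval_poly_carrier eval_poly_carrier v(1), symmetric]
      by blast
    ultimately show "0 < v \<bullet> ((A - eval_poly n p ?Z) *\<^sub>v v)"
      unfolding quadratic_form_minus[OF carr(1) eval_poly_carrier v(1)] x_def y_def
      by (simp add: algebra_simps)
  qed
  with Z show "?Z \<in> sublevel_set n p A" by (simp add: sublevel_set_def)
qed

section \<open>Subtracting the constant term\<close>

lemma shifted_sublevel_set:
  fixes p :: "('g::finite) free_poly"
  assumes A: "A \<in> carrier_mat n n"
  shows "sublevel_set n (p - value_at_zero p) A
    = sublevel_set n p (A + Poly_Mapping.lookup p [] \<cdot>\<^sub>m 1\<^sub>m n)"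
proof -
  have "eval_poly n (p - value_at_zero p) X $$ (i, k)
      = eval_poly n p X $$ (i, k) - Poly_Mapping.lookup p [] * (if i = k then 1 else 0)"
    if "i < n" "k < n" for X i k
    using that functional_diff[of "\<lambda>w. eval_word n X w $$ (i, k)" p "value_at_zero p"]
    by (simp add: eval_poly_def functional_def[symmetric] value_at_zero_def)
  moreover have "dim_row (eval_poly n q X) = n" "dim_col (eval_poly n q X) = n" for q :: "'g free_poly" and X
    by (simp_all add: eval_poly_def)
  ultimately have "A - eval_poly n (p - value_at_zero p) X
      = A + Poly_Mapping.lookup p [] \<cdot>\<^sub>m 1\<^sub>m n - eval_poly n p X" for X
    using A by (intro eq_matI) auto
  then show ?thesis by (simp add: sublevel_set_def)
qed

lemma symmetric_poly_diff_value_at_zero: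
  "symmetric_poly p \<Longrightarrow> symmetric_poly (p - value_at_zero p)"
  by (simp add: symmetric_poly_iff lookup_minus lookup_value_at_zero)

text \<open>
  At the tuples \<open>F\<close> and \<open>- F\<close> the vacuum sees every nonzero \<open>h\<^sub>j\<close>, so both values of the quasi-convex
  function at the vacuum lie strictly below its value at the midpoint \<open>0\<close>.
\<close>

lemma no_negative_sum_of_squares:
  fixes p :: "('g::finite) free_poly"
  assumes p: "symmetric_poly p"
    and conv: "\<And>n A. 0 < n \<Longrightarrow> A \<in> sym_mats n \<Longrightarrow> convex_tuples (sublevel_set n p A)"
    and sos: "sum_of_squares (value_at_zero p - p)"
  shows "value_at_zero p - p = 0"
proof -
  obtain m :: nat and h where h: "value_at_zero p - p = (\<Sum>j<m. adjoint_poly (h j) * h j)"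
    using sos by (auto simp: sum_of_squares_def)
  define d where "d = Max (insert 0 (length ` (\<Union>j<m. Poly_Mapping.keys (h j))))"
  let ?W = "words d :: 'g list set"
  have keys: "Poly_Mapping.keys (h j) \<subseteq> ?W" if "j < m" for j
    using that by (auto simp: words_def d_def intro!: Max_ge)
  define F where "F = (\<lambda>\<sigma> a u k. \<sigma> * fock (a :: 'g) u k)"
  have F: "symmetric_kernels ?W (F \<sigma>)" for \<sigma>
    using symmetric_kernels_fock[of ?W] by (simp add: F_def symmetric_kernels_def)
  define P where "P = Poly_Mapping.lookup p [] * ip ?W vacuum vacuum"
  define y where "y = (\<lambda>\<sigma> j i. \<Sum>w\<in>?W. Poly_Mapping.lookup (h j) w * act ?W (F \<sigma>) w vacuum i)"
  have qform: "qform ?W (F \<sigma>) p vacuum = P - (\<Sum>j<m. ip ?W (y \<sigma> j) (y \<sigma> j))" for \<sigma>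
  proof -
    have "qform ?W (F \<sigma>) (value_at_zero p - p) vacuum = (\<Sum>j<m. ip ?W (y \<sigma> j) (y \<sigma> j))"
      unfolding h y_def
      by (simp add: qform_def functional_sum)
        (simp add: qform_def[symmetric] qform_square[OF F finite_words keys])
    moreover have "qform ?W (F \<sigma>) (value_at_zero p) vacuum = P"
      by (simp add: qform_def value_at_zero_def P_def)
    ultimately show ?thesis by (simp add: qform_diff)
  qed
  have "h j = 0" if j: "j < m" for j
  proof (rule ccontr)
    assume "h j \<noteq> 0"
    then obtain u where u: "Poly_Mapping.lookup (h j) u \<noteq> 0"
      using poly_mapping_eqI[of "h j" 0] by auto
    then have uW: "u \<in> ?W" using keys[OF j] by (auto simp: in_keys_iff)
    have positive: "0 < ip ?W (y \<sigma> j) (y \<sigma> j)" if \<sigma>: "\<sigma> = 1 \<or> \<sigma> = - 1" for \<sigma>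
    proof (rule ccontr)
      assume "\<not> 0 < ip ?W (y \<sigma> j) (y \<sigma> j)"
      then have "ip ?W (y \<sigma> j) (y \<sigma> j) = 0" using ip_self_nonneg[of ?W "y \<sigma> j"] by simp
      moreover have act: "act ?W (F \<sigma>) w vacuum = (\<lambda>i. \<sigma> ^ length w * act ?W fock w vacuum i)" for w
        using \<sigma> act_uminus[of ?W fock w vacuum] by (auto simp: F_def)
      obtain C where C: "(\<Sum>u\<in>?W. (c u)\<^sup>2) \<le>
          C * ip ?W (\<lambda>i. \<Sum>w\<in>?W. c w * act ?W fock w vacuum i)
                    (\<lambda>i. \<Sum>w\<in>?W. c w * act ?W fock w vacuum i)" for c
        using fock_lower_bound[of d] by blast
      ultimately have "(\<Sum>w\<in>?W. (Poly_Mapping.lookup (h j) w * \<sigma> ^ length w)\<^sup>2) \<le> 0"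
        using C[of "\<lambda>w. Poly_Mapping.lookup (h j) w * \<sigma> ^ length w"] unfolding y_def act
        by (simp add: mult.assoc)
      moreover have "0 < (\<Sum>w\<in>?W. (Poly_Mapping.lookup (h j) w * \<sigma> ^ length w)\<^sup>2)"
        using uW u \<sigma> by (intro sum_pos2[of ?W u]) auto
      ultimately show False by simp
    qed
    have "qform ?W (F \<sigma>) p vacuum < P" if "\<sigma> = 1 \<or> \<sigma> = - 1" for \<sigma>
    proof -
      have "0 < (\<Sum>j<m. ip ?W (y \<sigma> j) (y \<sigma> j))"
        using j positive[OF that] by (intro sum_pos2[of _ j]) (auto simp: ip_self_nonneg)
      then show ?thesis by (simp add: qform)
    qed
    then have "qform ?W (\<lambda>a i k. (F 1 a i k + F (- 1) a i k) / 2) p vacuum < P"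
      using conv by (intro scalar_midpoint[OF p finite_words F F]) auto
    moreover have "qform ?W (\<lambda>a i k. (F 1 a i k + F (- 1) a i k) / 2) p vacuum = P"
    proof -
      have zero: "(\<lambda>a i k. (F 1 a i k + F (- 1) a i k) / 2) = (\<lambda>_ _ _. 0)"
        by (simp add: F_def)
      have vac: "ip ?W vacuum (act ?W (\<lambda>_ _ _. 0) w vacuum)
          = (if w = [] then ip ?W vacuum vacuum else 0)" for w :: "'g list"
        by (cases w) (simp_all add: app_def ip_def)
      have "qform ?W (\<lambda>_ _ _. 0) p vacuum = (\<Sum>w\<in>Poly_Mapping.keys p. if w = [] then P else 0)"
        unfolding qform_def functional_def by (intro sum.cong refl) (simp add: vac P_def)
      then show ?thesis unfolding zero by (auto simp: P_def in_keys_iff)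
    qed
    ultimately show False by simp
  qed
  then show ?thesis unfolding h by simp
qed

lemma convex_quadratic_if_quasi_convex_not_neg_sos:
  fixes p :: "('g::finite) free_poly"
  assumes p: "symmetric_poly p" and qc: "quasi_convex (p - value_at_zero p)"
    and sos: "\<not> (value_at_zero p - p \<noteq> 0 \<and> sum_of_squares (value_at_zero p - p))"
  shows "convex_quadratic p"
proof -
  define f where "f = p - value_at_zero p"
  have f: "symmetric_poly f" using symmetric_poly_diff_value_at_zero[OF p] by (simp add: f_def)
  have conv: "convex_tuples (sublevel_set n f A)" if "0 < n" "pos_def n A" for n A
    using qc that by (simp add: quasi_convex_def f_def)
  have "convex_quadratic f"
  \<comment> \<open>Index sets of words suffice, because this is where the Gelfand-Naimark-Segal tuples live.\<close>
  proof (cases "\<exists>(J :: 'g list set) Y v. finite J \<and> symmetric_kernels J Y \<and> 0 < qform J Y f v")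
    case True
    then obtain J :: "'g list set" and Y v
      where "finite J" "symmetric_kernels J Y" "0 < qform J Y f v" by blast
    with f conv show ?thesis by (rule convex_quadratic_if_quasi_convex)
  next
    case False
    define d where "d = Max (insert 0 (length ` Poly_Mapping.keys f))"
    have "Poly_Mapping.keys f \<subseteq> words d" by (auto simp: words_def d_def)
    then have "Poly_Mapping.keys (- f) \<subseteq> words (2 * d)"
      by (auto simp: words_def)
    moreover have "symmetric_poly (- f)" using f by (simp add: symmetric_poly_iff)
    moreover have "0 \<le> qform (words d) X (- f) v"
      if "symmetric_kernels (words d) X" for X :: "'g \<Rightarrow> 'g list \<Rightarrow> _" and v
    proof -
      have "\<not> 0 < qform (words d) X f v" using False that finite_words by blast
      then show ?thesis by (simp add: qform_uminus)
    qed
    ultimately have "sum_of_squares (- f)"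
      using sum_of_squares_if_nonneg[of "- f" d] by blast
    then have "f = 0" using sos by (simp add: f_def)
    then show ?thesis by (simp add: convex_quadratic_def)
  qed
  moreover have lookup: "Poly_Mapping.lookup f w = Poly_Mapping.lookup p w" if "w \<noteq> []" for w
    using that by (simp add: f_def lookup_minus lookup_value_at_zero)
  have "Poly_Mapping.lookup f w = Poly_Mapping.lookup p w" if "2 < length w" for w
    using that by (intro lookup) auto
  ultimately show ?thesis by (simp add: convex_quadratic_def lookup)
qed

section \<open>Equivalence of the four conditions\<close>

theorem theorem1p3:
  fixes p :: "('g::finite) free_poly"
  assumes "symmetric_poly p"
  shows
    "((\<exists>l (m::nat) s. linear_poly l \<and> (\<forall>j<m. linear_poly (s j)) \<and>
        p - value_at_zero p = l + (\<Sum>j<m. adjoint_poly (s j) * s j))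
      \<longleftrightarrow> matrix_convex p)
    \<and> (matrix_convex p
      \<longleftrightarrow> (\<forall>n>0. \<forall>A\<in>sym_mats n. convex_tuples (sublevel_set n p A)))
    \<and> ((\<forall>n>0. \<forall>A\<in>sym_mats n. convex_tuples (sublevel_set n p A))
      \<longleftrightarrow> quasi_convex (p - value_at_zero p) \<and>
        \<not> (value_at_zero p - p \<noteq> 0 \<and> sum_of_squares (value_at_zero p - p)))"
  (is "(?i \<longleftrightarrow> ?ii) \<and> (?ii \<longleftrightarrow> ?iii) \<and> (?iii \<longleftrightarrow> ?iv)")
proof -
  have i: "?i \<longleftrightarrow> convex_quadratic p"
    by (rule convex_quadratic_iff_linear_plus_squares[OF assms])
  have i_ii: ?ii if ?i
    using that unfolding i by (rule matrix_convex_if_convex_quadratic[OF assms])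
  have ii_iii: ?iii if ?ii
    using convex_sublevel_if_matrix_convex[OF that] by blast
  have iii_iv: ?iv if iii: ?iii
  proof
    show "quasi_convex (p - value_at_zero p)"
      unfolding quasi_convex_def
    proof (intro conjI allI impI)
      show "symmetric_poly (p - value_at_zero p)"
        by (rule symmetric_poly_diff_value_at_zero[OF assms])
      show "value_at_zero (p - value_at_zero p) = 0"
        by (simp add: value_at_zero_def lookup_minus)
      fix n A assume n: "0 < n" and A: "pos_def n A"
      then have carr: "A \<in> carrier_mat n n" "transpose_mat A = A"
        by (auto simp: pos_def_def sym_mats_def)
      have one_smult: "1 \<cdot>\<^sub>m A = A" by (rule eq_matI) auto
      have "A + Poly_Mapping.lookup p [] \<cdot>\<^sub>m 1\<^sub>m n \<in> sym_mats n"
        using transpose_combination[OF carr(1) one_carrier_mat, of 1 "Poly_Mapping.lookup p []"]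
        by (simp add: sym_mats_def one_smult carr)
      then show "convex_tuples (sublevel_set n (p - value_at_zero p) A)"
        unfolding shifted_sublevel_set[OF carr(1)] using iii n by blast
    qed
    show "\<not> (value_at_zero p - p \<noteq> 0 \<and> sum_of_squares (value_at_zero p - p))"
      using no_negative_sum_of_squares[OF assms] iii by blast
  qed
  have iv_i: ?i if ?iv
    using that unfolding i by (blast intro: convex_quadratic_if_quasi_convex_not_neg_sos[OF assms])
  show ?thesis
  proof (intro conjI)
    show "?i \<longleftrightarrow> ?ii" by (rule iffI[OF i_ii iv_i[OF iii_iv[OF ii_iii]]])
    show "?ii \<longleftrightarrow> ?iii" by (rule iffI[OF ii_iii i_ii[OF iv_i[OF iii_iv]]])
    show "?iii \<longleftrightarrow> ?iv" by (rule iffI[OF iii_iv ii_iii[OF i_ii[OF iv_i]]])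
  qed
qed

end
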